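(* Let $N\ge 1$, $0<\rho\le 1$ and $M>0$. For $1\le m\le N$ let $K_m:\mathbb{R}\to\mathbb{R}$ be kernels with $K_m\in W^{1,1}(\mathbb{R})$, none of which vanishes identically on $\mathbb{R}$; let $u_{0,m}:\mathbb{R}\to\mathbb{R}$, $u_{0,m}\in H^1(\mathbb{R})$, with $u_{0,m}$ nontrivial for some $1\le m\le N$, and put $u_0=(u_{0,1},\dots,u_{0,N})^T$; let $T_m:H^1(\mathbb{R})\to H^1(\mathbb{R})$ be bounded linear operators with norms $0<\|T_m\|<\infty$. Let $g_m:\mathbb{R}^N\to\mathbb{R}$, $1\le m\le N$, satisfy $g_m(0)=0$, and suppose that $g=(g_1,\dots,g_N)$ satisfies $g|_I\in D_M$ and $g$ does not vanish identically in the ball $I$. Suppose that $$c_aM\left(\|u_0\|_{H^1(\mathbb{R},\mathbb{R}^N)}+1\right)^2Q\le\frac{\rho}{2}.$$ Define the map $\tau_g$ by $u=\tau_g v$, where for $1\le m\le N$ $$u_m(x)=[T_m(u_{0,m}+v_m)](x)\int_{-\infty}^{\infty}K_m(x-y)\,g_m(u_0(y)+v(y))\,dy,\qquad x\in\mathbb{R}.$$ Then $\tau_g$ maps $B_\rho$ into $B_\rho$ and $\tau_g:B_\rho\to B_\rho$ is a strict contraction (with respect to the norm of $H^1(\mathbb{R},\mathbb{R}^N)$). The unique fixed point $u_p$ of this map is the only solution in $B_\rho$ of the system $$u_{p,m}(x)=[T_m(u_{0,m}+u_{p,m})](x)\int_{-\infty}^{\infty}K_m(x-y)\,g_m(u_0(y)+u_p(y))\,dy,\qquad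 x\in\mathbb{R},\ 1\le m\le N.$$
   Context: All functions are real-valued. $H^1(\mathbb{R})=\{\phi:\mathbb{R}\to\mathbb{R}\mid \phi\in L^2(\mathbb{R}),\ d\phi/dx\in L^2(\mathbb{R})\}$ with norm $\|\phi\|_{H^1(\mathbb{R})}^2=\|\phi\|_{L^2(\mathbb{R})}^2+\|d\phi/dx\|_{L^2(\mathbb{R})}^2$. For $u=(u_1,\dots,u_N)^T$, $\|u\|_{H^1(\mathbb{R},\mathbb{R}^N)}^2=\sum_{m=1}^N\|u_m\|_{L^2(\mathbb{R})}^2+\sum_{m=1}^N\|du_m/dx\|_{L^2(\mathbb{R})}^2$. Also $\|K\|_{W^{1,1}(\mathbb{R})}=\|K\|_{L^1(\mathbb{R})}+\|dK/dx\|_{L^1(\mathbb{R})}$. $c_a>0$ is a constant for the algebra property of $H^1(\mathbb{R})$: for all $\phi_1,\phi_2\in H^1(\mathbb{R})$ one has $\phi_1\phi_2\in H^1(\mathbb{R})$ and $\|\phi_1\phi_2\|_{H^1(\mathbb{R})}\le c_a\|\phi_1\|_{H^1(\mathbb{R})}\|\phi_2\|_{H^1(\mathbb{R})}$. $Q:=\sqrt{\sum_{m=1}^N\|T_m\|^2\|K_m\|_{W^{1,1}(\mathbb{R})}^2}$, where $\|T_m\|$ is the operator norm on $H^1(\mathbb{R})$. $B_\rho:=\{u\in H^1(\mathbb{R},\mathbb{R}^N)\mid \|u\|_{H^1(\mathbb{R},\mathbb{R}^N)}\le\rho\}$. $I:=\{z\in\mathbb{R}^N\mid |z|_{\mathbb{R}^N}\le\frac{1}{\sqrt2}(\|u_0\|_{H^1(\mathbb{R},\mathbb{R}^N)}+1)\}$,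 a closed ball in the Euclidean norm. $D_M:=\{g=(g_1,\dots,g_N)\in C^1(I,\mathbb{R}^N)\mid \|g\|_{C^1(I,\mathbb{R}^N)}\le M\}$, where $\|g\|_{C^1(I,\mathbb{R}^N)}:=\sum_{m=1}^N\|g_m\|_{C^1(I)}$, $\|g_m\|_{C^1(I)}:=\|g_m\|_{C(I)}+\sum_{n=1}^N\left\|\frac{\partial g_m}{\partial z_n}\right\|_{C(I)}$, and $\|\phi\|_{C(I)}:=\max_{z\in I}|\phi(z)|$. Elements of $H^1(\mathbb{R})$ are identified with their continuous representatives. A strict contraction is a map that is Lipschitz with a constant strictly less than $1$. *)

theory Defs
  imports "HOL-Analysis.Analysis"
begin

section \<open>Sobolev spaces on the real line\<close>

definition test_function :: "(real \<Rightarrow> real) \<Rightarrow> bool" where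
  "test_function \<phi> \<longleftrightarrow>
     (\<forall>k x. ((deriv ^^ k) \<phi>) field_differentiable (at x)) \<and>
     compact (closure {x. \<phi> x \<noteq> 0})"

definition locally_integrable :: "(real \<Rightarrow> real) \<Rightarrow> bool" where
  "locally_integrable f \<longleftrightarrow> (\<forall>a b. f absolutely_integrable_on {a..b})"

definition has_weak_derivative :: "(real \<Rightarrow> real) \<Rightarrow> (real \<Rightarrow> real) \<Rightarrow> bool" where
  "has_weak_derivative f f' \<longleftrightarrow>
     locally_integrable f \<and> locally_integrable f' \<and>
     (\<forall>\<phi>. test_function \<phi> \<longrightarrow>
        (LINT x|lebesgue. f x * deriv \<phi> x) = - (LINT x|lebesgue. f' x * \<phi> x))"

definition weakly_differentiable :: "(real \<Rightarrow> real) \<Rightarrow> bool" where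
  "weakly_differentiable f \<longleftrightarrow> (\<exists>f'. has_weak_derivative f f')"

text \<open>A weak derivative is determined only up to a null set. The definitions below use
  \<open>weak_deriv f\<close> only through properties and integrals that do not depend on the
  representative chosen here.\<close>

definition weak_deriv :: "(real \<Rightarrow> real) \<Rightarrow> real \<Rightarrow> real" where
  "weak_deriv f = (SOME f'. has_weak_derivative f f')"

definition L2 :: "(real \<Rightarrow> real) set" where
  "L2 = {f. f \<in> borel_measurable lebesgue \<and> integrable lebesgue (\<lambda>x. (f x)\<^sup>2)}"

definition L2_norm :: "(real \<Rightarrow> real) \<Rightarrow> real" where
  "L2_norm f = sqrt (LINT x|lebesgue. (f x)\<^sup>2)"

definition L1_norm :: "(real \<Rightarrow> real) \<Rightarrow> real" where
  "L1_norm f = (LINT x|lebesgue. \<bar>f x\<bar>)"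

text \<open>Each class in $H^1$ is represented by its continuous representative, so that equality
  of elements of \<open>H1\<close> is equality of functions.\<close>

definition H1 :: "(real \<Rightarrow> real) set" where
  "H1 = {f. continuous_on UNIV f \<and> f \<in> L2 \<and> weakly_differentiable f \<and> weak_deriv f \<in> L2}"

definition H1_norm :: "(real \<Rightarrow> real) \<Rightarrow> real" where
  "H1_norm f = sqrt ((L2_norm f)\<^sup>2 + (L2_norm (weak_deriv f))\<^sup>2)"

text \<open>Elements of \<open>W11\<close> are arbitrary, not necessarily continuous, representatives.\<close>

definition W11 :: "(real \<Rightarrow> real) set" where
  "W11 = {f. integrable lebesgue f \<and> weakly_differentiable f \<and> integrable lebesgue (weak_deriv f)}"

definition W11_norm :: "(real \<Rightarrow> real) \<Rightarrow> real" where
  "W11_norm f = L1_norm f + L1_norm (weak_deriv f)"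

definition H1_algebra_constant :: "real \<Rightarrow> bool" where
  "H1_algebra_constant c \<longleftrightarrow> c > 0 \<and>
     (\<forall>\<phi>\<^sub>1\<in>H1. \<forall>\<phi>\<^sub>2\<in>H1. (\<lambda>x. \<phi>\<^sub>1 x * \<phi>\<^sub>2 x) \<in> H1 \<and>
        H1_norm (\<lambda>x. \<phi>\<^sub>1 x * \<phi>\<^sub>2 x) \<le> c * H1_norm \<phi>\<^sub>1 * H1_norm \<phi>\<^sub>2)"

definition H1_bounded_linear :: "((real \<Rightarrow> real) \<Rightarrow> (real \<Rightarrow> real)) \<Rightarrow> bool" where
  "H1_bounded_linear T \<longleftrightarrow>
     (\<forall>\<phi>\<in>H1. T \<phi> \<in> H1) \<and>
     (\<forall>\<phi>\<in>H1. \<forall>\<psi>\<in>H1. T (\<lambda>x. \<phi> x + \<psi> x) = (\<lambda>x. T \<phi> x + T \<psi> x)) \<and>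
     (\<forall>c. \<forall>\<phi>\<in>H1. T (\<lambda>x. c * \<phi> x) = (\<lambda>x. c * T \<phi> x)) \<and>
     (\<exists>C. \<forall>\<phi>\<in>H1. H1_norm (T \<phi>) \<le> C * H1_norm \<phi>)"

text \<open>As in \<^const>\<open>onorm\<close>, the zero function contributes \<open>0 / 0 = 0\<close>.\<close>

definition H1_onorm :: "((real \<Rightarrow> real) \<Rightarrow> (real \<Rightarrow> real)) \<Rightarrow> real" where
  "H1_onorm T = (SUP \<phi>\<in>H1. H1_norm (T \<phi>) / H1_norm \<phi>)"

section \<open>Vector-valued functions\<close>

definition H1_vec :: "(real \<Rightarrow> real ^ 'n) set" where
  "H1_vec = {u. \<forall>m. (\<lambda>x. u x $ m) \<in> H1}"

definition H1_vec_norm :: "(real \<Rightarrow> real ^ 'n) \<Rightarrow> real" where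
  "H1_vec_norm u = sqrt ((\<Sum>m\<in>UNIV. (L2_norm (\<lambda>x. u x $ m))\<^sup>2) +
     (\<Sum>m\<in>UNIV. (L2_norm (weak_deriv (\<lambda>x. u x $ m)))\<^sup>2))"

definition B_ball :: "real \<Rightarrow> (real \<Rightarrow> real ^ 'n) set" where
  "B_ball \<rho> = {u \<in> H1_vec. H1_vec_norm u \<le> \<rho>}"

definition I_ball :: "(real \<Rightarrow> real ^ 'n) \<Rightarrow> (real ^ 'n) set" where
  "I_ball u0 = cball 0 ((1 / sqrt 2) * (H1_vec_norm u0 + 1))"

section \<open>Continuously differentiable functions on a closed ball\<close>

text \<open>On the boundary of the ball \<open>S\<close> partial derivatives are read off the derivative within
  \<open>S\<close>, which is unique when \<open>S\<close> is a ball of positive radius; a difference quotient in a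
  coordinate direction would in general leave \<open>S\<close>.\<close>

definition partial_on :: "(real ^ 'n) set \<Rightarrow> 'n \<Rightarrow> (real ^ 'n \<Rightarrow> real) \<Rightarrow> real ^ 'n \<Rightarrow> real" where
  "partial_on S n f z = frechet_derivative f (at z within S) (axis n 1)"

definition C1_on :: "(real ^ 'n) set \<Rightarrow> (real ^ 'n \<Rightarrow> real) \<Rightarrow> bool" where
  "C1_on S f \<longleftrightarrow> f differentiable_on S \<and> (\<forall>n. continuous_on S (partial_on S n f))"

text \<open>For continuous \<open>f\<close> on a nonempty compact \<open>S\<close> this supremum is the maximum.\<close>

definition C_norm :: "(real ^ 'n) set \<Rightarrow> (real ^ 'n \<Rightarrow> real) \<Rightarrow> real" where
  "C_norm S f = (SUP z\<in>S. \<bar>f z\<bar>)"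

definition C1_norm :: "(real ^ 'n) set \<Rightarrow> (real ^ 'n \<Rightarrow> real) \<Rightarrow> real" where
  "C1_norm S f = C_norm S f + (\<Sum>n\<in>UNIV. C_norm S (partial_on S n f))"

definition C1_vec_norm :: "(real ^ 'n) set \<Rightarrow> (real ^ 'n \<Rightarrow> real ^ 'n) \<Rightarrow> real" where
  "C1_vec_norm S g = (\<Sum>m\<in>UNIV. C1_norm S (\<lambda>z. g z $ m))"

text \<open>Membership depends only on the values of \<open>g\<close> on \<open>S\<close>, so \<open>g \<in> D_set S M\<close> expresses
  that the restriction of \<open>g\<close> to \<open>S\<close> lies in $D_M$.\<close>

definition D_set :: "(real ^ 'n) set \<Rightarrow> real \<Rightarrow> (real ^ 'n \<Rightarrow> real ^ 'n) set" where
  "D_set S M = {g. (\<forall>m. C1_on S (\<lambda>z. g z $ m)) \<and> C1_vec_norm S g \<le> M}"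

section \<open>The nonlinear map\<close>

definition Q_const ::
  "('n::finite \<Rightarrow> (real \<Rightarrow> real) \<Rightarrow> (real \<Rightarrow> real)) \<Rightarrow> ('n \<Rightarrow> real \<Rightarrow> real) \<Rightarrow> real" where
  "Q_const T K = sqrt (\<Sum>m\<in>UNIV. (H1_onorm (T m))\<^sup>2 * (W11_norm (K m))\<^sup>2)"

definition tau ::
  "('n \<Rightarrow> (real \<Rightarrow> real) \<Rightarrow> (real \<Rightarrow> real)) \<Rightarrow> ('n \<Rightarrow> real \<Rightarrow> real) \<Rightarrow> (real \<Rightarrow> real ^ 'n) \<Rightarrow>
   (real ^ 'n \<Rightarrow> real ^ 'n) \<Rightarrow> (real \<Rightarrow> real ^ 'n) \<Rightarrow> real \<Rightarrow> real ^ 'n" where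
  "tau T K u0 g v = (\<lambda>x. \<chi> m. T m (\<lambda>y. u0 y $ m + v y $ m) x *
     (LINT y|lebesgue. K m (x - y) * g (u0 y + v y) $ m))"

definition strict_contraction_on ::
  "(real \<Rightarrow> real ^ 'n) set \<Rightarrow> ((real \<Rightarrow> real ^ 'n) \<Rightarrow> (real \<Rightarrow> real ^ 'n)) \<Rightarrow> bool" where
  "strict_contraction_on B f \<longleftrightarrow>
     (\<exists>q. 0 \<le> q \<and> q < 1 \<and>
       (\<forall>v\<in>B. \<forall>w\<in>B. H1_vec_norm (\<lambda>x. f v x - f w x) \<le> q * H1_vec_norm (\<lambda>x. v x - w x)))"

end

theory Submission
  imports Defs
begin

text \<open>Write $R = \|u_0\| + 1$, where $\|\cdot\|$ is the norm of vector-valued $H^1$ functions. The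
  map is a product of a bounded operator and a convolution, and both factors gain only constants.
  If $\|v\| \le \rho \le 1$, then $\|u_0 + v\| \le R$, and the Sobolev embedding
  $|f(x)| \le \|f\| / \sqrt{2}$ keeps all values of $u_0 + v$ in the ball $I$
  (\<open>H1_vec_sup_bound\<close>). On this convex set $g_m$ is Lipschitz with constant
  $\|g_m\|_{C^1} \le M$ (\<open>C1_norm_Lipschitz\<close>), so with $g_m(0) = 0$ the function
  $g_m(u_0 + v)$ is square integrable with norm at most $M R$. Convolution with $K_m$ maps it into
  $H^1$: by Young's inequality $K_m * G$ and its weak derivative $K_m' * G$ have $L^2$ norms at most
  $\|K_m\|_{L^1} \|G\|_{L^2}$ and $\|K_m'\|_{L^1} \|G\|_{L^2}$
  (\<open>W11_convolution_H1\<close>). The algebra property then bounds component $m$ of the image by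
  $c_a M R^2 \|T_m\| \|K_m\|$ (\<open>H1_norm_product_estimate\<close>), and summing squares gives
  $c_a M R^2 Q \le \rho / 2$.

  For the contraction, the difference of two images is written as
  $T_m(v_m - w_m) \cdot K_m * g_m(u_0 + v)
    + T_m(u_{0,m} + w_m) \cdot K_m * (g_m(u_0 + v) - g_m(u_0 + w))$.
  The same estimate bounds each summand by $c_a M R \|T_m\| \|K_m\| \|v - w\|$, which yields the
  Lipschitz constant $q = 2 c_a M R Q \le \rho / R$. It is less than $1$ because $u_0$ is nontrivial,
  that is $R > 1$, and $\rho \le 1$. Banach's principle in the complete space $H^1$ finishes the
  proof (\<open>strict_contraction_fixed_point\<close>).

  The analysis below rests on one fact: a continuous $f$ with weak derivative $d$ satisfies
  $f(b) - f(a) = \int_a^b d$ (\<open>weak_derivative_FTC\<close>), obtained by testing with smooth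
  approximations of the indicator function of $[a, b]$. It makes the weak derivative unique almost
  everywhere, so that the norm of $H^1$ can be computed from any weak derivative, and together with
  Fubini's theorem it gives the Sobolev embedding.\<close>

section \<open>Smooth functions and a smooth step\<close>

definition smooth :: "(real \<Rightarrow> real) \<Rightarrow> bool" where
  "smooth f \<longleftrightarrow> (\<forall>k x. ((deriv ^^ k) f) field_differentiable (at x))"

text \<open>Closure properties of smooth functions involve all derivatives at once. Instead of iterated
  Leibniz or chain rules it suffices to exhibit a family of differentiable functions that contains
  its own derivatives.\<close>

lemma smooth_family:
  assumes "f \<in> S"
    and "\<And>h. h \<in> S \<Longrightarrow> (\<forall>x. h field_differentiable (at x)) \<and> deriv h \<in> S"
  shows "smooth f"
proof -
  have "(deriv ^^ k) f \<in> S" for k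
    by (induction k) (use assms in auto)
  then show ?thesis
    unfolding smooth_def using assms(2) by blast
qed

lemma smooth_has_derivative:
  "smooth f \<Longrightarrow> (f has_real_derivative deriv f x) (at x)"
  unfolding smooth_def
  by (metis DERIV_deriv_iff_field_differentiable funpow_0)

lemma smooth_deriv: "smooth f \<Longrightarrow> smooth (deriv f)"
  unfolding smooth_def
  by (metis funpow_Suc_right o_apply)

lemma smooth_antiderivative:
  assumes "smooth h" and "\<And>x. (H has_real_derivative h x) (at x)"
  shows "smooth H"
  unfolding smooth_def
proof (intro allI)
  fix k x
  have "deriv H = h"
    using assms(2) by (auto intro!: DERIV_imp_deriv)
  then show "((deriv ^^ k) H) field_differentiable (at x)"
    using assms unfolding smooth_def
    by (cases k) (auto simp: funpow_Suc_right field_differentiable_def simp del: funpow.simps)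
qed

lemma smooth_affine:
  assumes "smooth f"
  shows "smooth (\<lambda>x. f (a + c * x))"
proof (rule smooth_family[where S = "{\<lambda>x. C * h (a + c * x) |C h. smooth h}"])
  show "(\<lambda>x. f (a + c * x)) \<in> {\<lambda>x. C * h (a + c * x) |C h. smooth h}"
    using assms by (auto intro!: exI[of _ 1] exI[of _ f])
next
  fix k assume "k \<in> {\<lambda>x. C * h (a + c * x) |C h. smooth h}"
  then obtain C h where k: "k = (\<lambda>x. C * h (a + c * x))" and h: "smooth h"
    by auto
  have *: "(k has_real_derivative (C * c) * deriv h (a + c * x)) (at x)" for x
    unfolding k
    by (rule derivative_eq_intros DERIV_chain2[OF smooth_has_derivative[OF h]] refl | simp)+
  then have "deriv k = (\<lambda>x. (C * c) * deriv h (a + c * x))"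
    by (auto intro!: DERIV_imp_deriv)
  then show "(\<forall>x. k field_differentiable (at x)) \<and> deriv k \<in> {\<lambda>x. C * h (a + c * x) |C h. smooth h}"
    using * smooth_deriv[OF h] by (auto simp: field_differentiable_def)
qed

lemma smooth_diff:
  assumes "smooth f" "smooth g"
  shows "smooth (\<lambda>x. f x - g x)"
proof (rule smooth_family[where S = "{\<lambda>x. a x - b x |a b. smooth a \<and> smooth b}"])
  show "(\<lambda>x. f x - g x) \<in> {\<lambda>x. a x - b x |a b. smooth a \<and> smooth b}"
    using assms by auto
next
  fix k assume "k \<in> {\<lambda>x. a x - b x |a b. smooth a \<and> smooth b}"
  then obtain a b where k: "k = (\<lambda>x. a x - b x)" and h: "smooth a" "smooth b"
    by auto
  have *: "(k has_real_derivative deriv a x - deriv b x) (at x)" for x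
    unfolding k using h by (auto intro!: derivative_eq_intros smooth_has_derivative)
  then have "deriv k = (\<lambda>x. deriv a x - deriv b x)"
    by (auto intro!: DERIV_imp_deriv)
  then show "(\<forall>x. k field_differentiable (at x)) \<and> deriv k \<in> {\<lambda>x. a x - b x |a b. smooth a \<and> smooth b}"
    using * h[THEN smooth_deriv] by (auto simp: field_differentiable_def)
qed

text \<open>Products alone are not closed under differentiation; finite sums of products are.\<close>

lemma smooth_mult:
  assumes "smooth f" "smooth g"
  shows "smooth (\<lambda>x. f x * g x)"
proof -
  define S where "S = {\<lambda>x. \<Sum>i<n. a i x * b i x |(n::nat) a b. (\<forall>i. smooth (a i)) \<and> (\<forall>i. smooth (b i))}"
  show ?thesis
  proof (rule smooth_family[where S = S])
    show "(\<lambda>x. f x * g x) \<in> S"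
      unfolding S_def using assms
      by (intro CollectI exI[of _ "1::nat"] exI[of _ "\<lambda>_. f"] exI[of _ "\<lambda>_. g"]) simp
  next
    fix k assume "k \<in> S"
    then obtain n :: nat and a b where k: "k = (\<lambda>x. \<Sum>i<n. a i x * b i x)"
      and ab: "\<And>i. smooth (a i)" "\<And>i. smooth (b i)"
      unfolding S_def by auto
    have *: "(k has_real_derivative (\<Sum>i<n. deriv (a i) x * b i x + deriv (b i) x * a i x)) (at x)" for x
      unfolding k
      by (intro DERIV_sum DERIV_mult smooth_has_derivative ab)
    \<comment> \<open>The \<open>2 * n\<close> products of the Leibniz rule, listed pairwise.\<close>
    have split2: "(\<Sum>i<2*n. c i) = (\<Sum>i<n. c (2*i) + c (2*i+1))" for c :: "nat \<Rightarrow> real" and n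
      by (induction n) auto
    define a' where "a' i = (if even i then deriv (a (i div 2)) else deriv (b (i div 2)))" for i
    define b' where "b' i = (if even i then b (i div 2) else a (i div 2))" for i
    have "deriv k = (\<lambda>x. \<Sum>i<2*n. a' i x * b' i x)"
      unfolding split2 a'_def b'_def
      using * by (auto intro!: DERIV_imp_deriv)
    moreover have "smooth (a' i)" "smooth (b' i)" for i
      by (auto simp: a'_def b'_def ab smooth_deriv)
    ultimately have "deriv k \<in> S"
      unfolding S_def by blast
    then show "(\<forall>x. k field_differentiable (at x)) \<and> deriv k \<in> S"
      using * by (auto simp: field_differentiable_def)
  qed
qed

text \<open>The classical flat functions: every derivative of $e^{-1/x}$ is a polynomial in $1/x$ times
  $e^{-1/x}$, and all of them extend by zero to the negative axis.\<close>

definition flat :: "real poly \<Rightarrow> real \<Rightarrow> real" where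
  "flat p x = (if x > 0 then poly p (1 / x) * exp (- (1 / x)) else 0)"

lemma poly_times_exp_tendsto_0:
  "((\<lambda>y. poly p y * exp (- y)) \<longlongrightarrow> (0::real)) at_top"
proof -
  have "((\<lambda>y. \<Sum>i\<le>degree p. coeff p i * (y ^ i / exp y)) \<longlongrightarrow> (\<Sum>i\<le>degree p. coeff p i * (0::real))) at_top"
    by (intro tendsto_intros tendsto_power_div_exp_0)
  then show ?thesis
    by (simp add: poly_altdef exp_minus sum_distrib_right divide_inverse mult.assoc)
qed

text \<open>Substituting $y = 1/x$, the exponential beats the polynomial. Applied to \<open>monom 1 1 * p\<close>,
  that is to the difference quotient at zero, this also gives the derivative there.\<close>

lemma flat_tendsto_0: "(flat p \<longlongrightarrow> 0) (at 0)"
proof -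
  have "((\<lambda>x. poly p (1/x) * exp (- (1/x))) \<longlongrightarrow> 0) (at_right 0)"
    by (rule filterlim_compose[OF poly_times_exp_tendsto_0])
       (simp add: divide_inverse filterlim_inverse_at_top_right)
  then have "(flat p \<longlongrightarrow> 0) (at_right 0)"
    by (rule Lim_transform_eventually)
       (auto simp: flat_def eventually_at_filter)
  moreover have "(flat p \<longlongrightarrow> 0) (at_left 0)"
    by (rule tendsto_eventually) (auto simp: flat_def eventually_at_filter)
  ultimately show ?thesis
    by (simp add: filterlim_split_at)
qed

lemma flat_has_derivative:
  "(flat p has_real_derivative flat (monom 1 2 * (p - pderiv p)) x) (at x)"
proof -
  consider "x > 0" | "x < 0" | "x = 0" by linarith
  then show ?thesis
  proof cases
    case 1
    have "((\<lambda>x. poly p (1/x) * exp (- (1/x))) has_real_derivative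
        flat (monom 1 2 * (p - pderiv p)) x) (at x)"
      using 1
      by (auto intro!: derivative_eq_intros DERIV_chain2[OF poly_DERIV]
          simp: flat_def poly_monom field_simps power2_eq_square)
    then show ?thesis
      by (rule has_field_derivative_transform_within_open[where S = "{0<..}"])
         (use 1 in \<open>auto simp: flat_def\<close>)
  next
    case 2
    have "((\<lambda>x. 0) has_real_derivative flat (monom 1 2 * (p - pderiv p)) x) (at x)"
      using 2 by (auto simp: flat_def)
    then show ?thesis
      by (rule has_field_derivative_transform_within_open[where S = "{..<0}"])
         (use 2 in \<open>auto simp: flat_def\<close>)
  next
    case 3
    have "(flat (monom 1 1 * p) \<longlongrightarrow> 0) (at 0)"
      by (rule flat_tendsto_0)
    moreover have "flat (monom 1 1 * p) = (\<lambda>h. (flat p (0 + h) - flat p 0) / h)"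
      by (auto simp: flat_def poly_monom)
    ultimately show ?thesis
      using 3 by (simp add: DERIV_def flat_def)
  qed
qed

lemma smooth_flat: "smooth (flat p)"
proof (rule smooth_family[where S = "range flat"])
  fix h assume "h \<in> range flat"
  then obtain q where h: "h = flat q" by auto
  have "deriv h = flat (monom 1 2 * (q - pderiv q))"
    unfolding h using flat_has_derivative by (auto intro!: DERIV_imp_deriv)
  then show "(\<forall>x. h field_differentiable (at x)) \<and> deriv h \<in> range flat"
    using flat_has_derivative h by (auto simp: field_differentiable_def)
qed auto

lemma smooth_continuous_on: "smooth f \<Longrightarrow> continuous_on A f"
  by (meson DERIV_isCont continuous_at_imp_continuous_on smooth_has_derivative)

lemma smooth_isCont: "smooth f \<Longrightarrow> isCont f x"
  by (meson DERIV_isCont smooth_has_derivative)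

text \<open>The step is a normalised antiderivative of the bump $e^{-1/x} e^{-1/(1-x)}$, which is positive
  exactly on the open unit interval.\<close>

lemma smooth_step_exists:
  obtains H :: "real \<Rightarrow> real" where "smooth H"
    "\<And>x. x \<le> 0 \<Longrightarrow> H x = 0" "\<And>x. x \<ge> 1 \<Longrightarrow> H x = 1" "\<And>x. 0 \<le> H x" "\<And>x. H x \<le> 1"
proof -
  define \<eta> where "\<eta> = (\<lambda>x. flat 1 x * flat 1 (1 + (-1) * x))"
  have sm: "smooth \<eta>"
    unfolding \<eta>_def by (intro smooth_mult smooth_affine smooth_flat)
  have nonneg: "\<eta> x \<ge> 0" for x
    by (auto simp: \<eta>_def flat_def)
  have pos: "\<eta> x > 0" if "0 < x" "x < 1" for x
    using that by (auto simp: \<eta>_def flat_def)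
  have zero: "\<eta> x = 0" if "x \<le> 0 \<or> x \<ge> 1" for x
    using that by (auto simp: \<eta>_def flat_def)
  have "\<exists>F. \<forall>x::real. - \<infinity> < ereal x \<longrightarrow> ereal x < \<infinity> \<longrightarrow> (F has_vector_derivative \<eta> x) (at x)"
    by (rule einterval_antiderivative)
       (auto intro: smooth_isCont[OF sm])
  then obtain F where F: "\<And>x. (F has_real_derivative \<eta> x) (at x)"
    by (auto simp: has_real_derivative_iff_has_vector_derivative)
  have mono: "F x \<le> F y" if "x \<le> y" for x y
    using DERIV_nonneg_imp_nondecreasing[OF that, of F] F nonneg by blast
  have F0: "F x = F 0" if "x \<le> 0" for x
  proof -
    have "\<exists>c. \<forall>x\<in>{..0}. F x = c"
      by (rule has_field_derivative_zero_constant)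
         (auto intro!: has_field_derivative_at_within F[THEN DERIV_cong] zero)
    then show ?thesis using that by auto
  qed
  have F1: "F x = F 1" if "x \<ge> 1" for x
  proof -
    have "\<exists>c. \<forall>x\<in>{1..}. F x = c"
      by (rule has_field_derivative_zero_constant)
         (auto intro!: has_field_derivative_at_within F[THEN DERIV_cong] zero)
    then show ?thesis using that by auto
  qed
  have lt: "F 0 < F 1"
  proof (rule DERIV_pos_imp_increasing_open[of 0 1])
    show "\<exists>y. (F has_real_derivative y) (at x) \<and> 0 < y" if "0 < x" "x < 1" for x
      using F pos that by blast
    show "continuous_on {0..1} F"
      by (meson DERIV_isCont F continuous_at_imp_continuous_on)
  qed simp
  define c where "c = F 1 - F 0"
  have c: "c > 0" using lt by (simp add: c_def)
  define H where "H x = (F x - F 0) / c" for x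
  have dH: "(H has_real_derivative \<eta> x * (1 / c)) (at x)" for x
    unfolding H_def[abs_def] using c by (auto intro!: derivative_eq_intros F)
  have "smooth (\<lambda>x. 1 / c)"
    by (rule smooth_family[where S = "range (\<lambda>c x. c)"]) auto
  then have "smooth (\<lambda>x. \<eta> x * (1 / c))"
    using sm by (intro smooth_mult)
  then have "smooth H"
    using dH by (rule smooth_antiderivative)
  moreover have "H x = 0" if "x \<le> 0" for x
    using F0[OF that] by (simp add: H_def)
  moreover have "H x = 1" if "x \<ge> 1" for x
    using F1[OF that] c by (simp add: H_def c_def)
  moreover have "0 \<le> H x" for x
    using mono[of 0 x] F0[of x] c by (cases "x \<ge> 0") (auto simp: H_def)
  moreover have "H x \<le> 1" for x
    using mono[of x 1] F1[of x] c by (cases "x \<le> 1") (auto simp: H_def c_def)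
  ultimately show ?thesis using that by blast
qed

section \<open>Test functions and locally integrable functions\<close>

lemma continuous_measurable_lebesgue:
  fixes f :: "real \<Rightarrow> real"
  shows "continuous_on UNIV f \<Longrightarrow> f \<in> borel_measurable lebesgue"
  by (simp add: borel_measurable_continuous_onI measurable_completion)

lemma smooth_measurable: "smooth f \<Longrightarrow> f \<in> borel_measurable borel"
  by (intro borel_measurable_continuous_onI smooth_continuous_on)

lemma locally_integrable_mult_bounded:
  assumes d: "locally_integrable d" and \<phi>: "\<phi> \<in> borel_measurable lebesgue"
    and C: "\<And>x. \<bar>\<phi> x\<bar> \<le> C" and supp: "\<And>x. x \<notin> {a..b} \<Longrightarrow> \<phi> x = 0"
  shows "integrable lebesgue (\<lambda>x. d x * \<phi> x)"
proof -
  have i: "integrable lebesgue (\<lambda>x. indicator {a..b} x * d x)"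
    using d unfolding locally_integrable_def set_integrable_def by simp
  have "integrable lebesgue (\<lambda>x. (indicator {a..b} x * d x) * \<phi> x)"
  proof (rule Bochner_Integration.integrable_bound)
    show "integrable lebesgue (\<lambda>x. C * (indicator {a..b} x * d x))"
      using i by (rule integrable_mult_right)
    show "(\<lambda>x. (indicator {a..b} x * d x) * \<phi> x) \<in> borel_measurable lebesgue"
      using i \<phi> by measurable
    have "0 \<le> C" using C[of 0] by linarith
    then show "AE x in lebesgue. norm ((indicator {a..b} x * d x) * \<phi> x) \<le> norm (C * (indicator {a..b} x * d x))"
      using C by (intro always_eventually allI)
        (simp add: abs_mult mult.commute mult_right_mono)
  qed
  moreover have "(indicator {a..b} x * d x) * \<phi> x = d x * \<phi> x" for x
    using supp[of x] by (cases "x \<in> {a..b}") auto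
  ultimately show ?thesis by simp
qed

lemma test_function_smooth: "test_function \<phi> \<Longrightarrow> smooth \<phi>"
  by (simp add: test_function_def smooth_def)

lemma test_functionI:
  assumes "smooth \<phi>" and "\<And>x. x \<notin> {a..b} \<Longrightarrow> \<phi> x = 0"
  shows "test_function \<phi>"
proof -
  have "{x. \<phi> x \<noteq> 0} \<subseteq> {a..b}"
    using assms(2) by blast
  then have "bounded {x. \<phi> x \<noteq> 0}"
    by (rule bounded_subset[OF bounded_closed_interval])
  then have "compact (closure {x. \<phi> x \<noteq> 0})"
    by (simp add: compact_closure)
  with assms(1) show ?thesis
    by (simp add: test_function_def smooth_def)
qed

lemma continuous_on_Icc_bounded:
  fixes h :: "real \<Rightarrow> real"
  assumes "continuous_on {a..b} h"
  obtains C where "\<And>x. x \<in> {a..b} \<Longrightarrow> \<bar>h x\<bar> \<le> C"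
proof -
  have "bounded (h ` {a..b})"
    by (intro compact_imp_bounded compact_continuous_image assms compact_Icc)
  then show ?thesis
    using that unfolding bounded_iff by (metis image_eqI real_norm_def)
qed

lemma test_function_bounds:
  assumes "test_function \<phi>"
  obtains C a b where "\<And>x. \<bar>\<phi> x\<bar> \<le> C" "\<And>x. \<bar>deriv \<phi> x\<bar> \<le> C"
    "\<And>x. x \<notin> {a..b} \<Longrightarrow> \<phi> x = 0" "\<And>x. x \<notin> {a..b} \<Longrightarrow> deriv \<phi> x = 0"
proof -
  have sm: "smooth \<phi>" using assms by (rule test_function_smooth)
  have "compact (closure {x. \<phi> x \<noteq> 0})"
    using assms unfolding test_function_def by (rule conjunct2)
  then have "bounded {x. \<phi> x \<noteq> 0}"
    using bounded_closure_image bounded_subset closure_subset compact_imp_bounded by metis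
  then obtain r where r: "\<And>x. x \<in> {x. \<phi> x \<noteq> 0} \<Longrightarrow> norm x \<le> r"
    unfolding bounded_iff by metis
  have zero: "\<phi> x = 0" if "x \<notin> {-r..r}" for x
    using that r[of x] by (cases "\<phi> x = 0") auto
  have dzero: "deriv \<phi> x = 0" if "x \<notin> {-r..r}" for x
  proof (rule DERIV_imp_deriv)
    show "(\<phi> has_real_derivative 0) (at x)"
      by (rule has_field_derivative_transform_within_open[of "\<lambda>_. 0" _ _ "- {-r..r}"])
         (use that zero in auto)
  qed
  have "\<exists>C. \<forall>x. \<bar>h x\<bar> \<le> C" if hs: "smooth h" and z: "\<And>x. x \<notin> {-r..r} \<Longrightarrow> h x = 0" for h
  proof -
    obtain C where C: "\<And>x. x \<in> {-r..r} \<Longrightarrow> \<bar>h x\<bar> \<le> C"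
      using continuous_on_Icc_bounded[OF smooth_continuous_on[OF hs]] by blast
    have "\<bar>h x\<bar> \<le> max C 0" for x
      using C[of x] z[of x] by (cases "x \<in> {-r..r}") auto
    then show ?thesis by blast
  qed
  from this[OF sm zero] this[OF smooth_deriv[OF sm] dzero]
  obtain C1 C2 where "\<And>x. \<bar>\<phi> x\<bar> \<le> C1" "\<And>x. \<bar>deriv \<phi> x\<bar> \<le> C2" by blast
  then show ?thesis
    using that[of "max C1 C2" "-r" r] zero dzero by (metis max.coboundedI1 max.coboundedI2)
qed

lemma test_function_integrable:
  assumes "test_function \<phi>" "locally_integrable d"
  shows "integrable lebesgue (\<lambda>x. d x * \<phi> x)" "integrable lebesgue (\<lambda>x. d x * deriv \<phi> x)"
proof -
  obtain C a b where *: "\<And>x. \<bar>\<phi> x\<bar> \<le> C" "\<And>x. \<bar>deriv \<phi> x\<bar> \<le> C"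
    "\<And>x. x \<notin> {a..b} \<Longrightarrow> \<phi> x = 0" "\<And>x. x \<notin> {a..b} \<Longrightarrow> deriv \<phi> x = 0"
    by (rule test_function_bounds[OF assms(1)]) (rule that)
  have "smooth \<phi>" "smooth (deriv \<phi>)"
    using assms(1) by (auto intro: test_function_smooth smooth_deriv)
  then have "\<phi> \<in> borel_measurable lebesgue" "deriv \<phi> \<in> borel_measurable lebesgue"
    by (auto intro!: continuous_measurable_lebesgue smooth_continuous_on)
  then show "integrable lebesgue (\<lambda>x. d x * \<phi> x)" "integrable lebesgue (\<lambda>x. d x * deriv \<phi> x)"
    using * assms(2) by (blast intro: locally_integrable_mult_bounded)+
qed

lemma continuous_locally_integrable:
  "continuous_on UNIV f \<Longrightarrow> locally_integrable f"
  unfolding locally_integrable_def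
  by (auto intro!: absolutely_integrable_continuous_real intro: continuous_on_subset)

lemma test_function_affine:
  assumes "test_function \<phi>" "c \<noteq> 0"
  shows "test_function (\<lambda>x. \<phi> (t + c * x))"
proof -
  obtain C a b where "\<And>x. \<bar>\<phi> x\<bar> \<le> C" "\<And>x. \<bar>deriv \<phi> x\<bar> \<le> C"
    and z: "\<And>x. x \<notin> {a..b} \<Longrightarrow> \<phi> x = 0" and "\<And>x. x \<notin> {a..b} \<Longrightarrow> deriv \<phi> x = 0"
    by (rule test_function_bounds[OF assms(1)]) (rule that)
  define R where "R = (\<bar>t\<bar> + \<bar>a\<bar> + \<bar>b\<bar>) / \<bar>c\<bar>"
  show ?thesis
  proof (rule test_functionI)
    show "smooth (\<lambda>x. \<phi> (t + c * x))"
      by (intro smooth_affine test_function_smooth assms)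
    show "\<phi> (t + c * x) = 0" if "x \<notin> {-R..R}" for x
    proof (rule z)
      have "\<bar>x\<bar> > R" using that by auto
      then have "\<bar>c * x\<bar> > \<bar>t\<bar> + \<bar>a\<bar> + \<bar>b\<bar>"
        using assms(2) by (simp add: R_def field_simps abs_mult)
      then show "t + c * x \<notin> {a..b}" by auto
    qed
  qed
qed

lemma smooth_step_deriv_test_function:
  assumes H: "smooth H"
    and H0: "\<And>x. x \<le> 0 \<Longrightarrow> H x = 0" and H1: "\<And>x. x \<ge> 1 \<Longrightarrow> H x = 1"
  shows "test_function (deriv H)" and "x \<notin> {0..1} \<Longrightarrow> deriv H x = 0"
proof -
  show *: "deriv H x = 0" if "x \<notin> {0..1}" for x
  proof (rule DERIV_imp_deriv)
    consider "x < 0" | "x > 1" using \<open>x \<notin> {0..1}\<close> by fastforce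
    then show "(H has_real_derivative 0) (at x)"
    proof cases
      case 1
      show ?thesis
        by (rule has_field_derivative_transform_within_open[of "\<lambda>_. 0" _ _ "{..<0}"])
           (use 1 H0 in auto)
    next
      case 2
      show ?thesis
        by (rule has_field_derivative_transform_within_open[of "\<lambda>_. 1" _ _ "{1<..}"])
           (use 2 H1 in auto)
    qed
  qed
  show "test_function (deriv H)"
    by (rule test_functionI[OF smooth_deriv[OF H] *])
qed

section \<open>The fundamental theorem of calculus for weak derivatives\<close>

text \<open>The functions $n H'(n (x - a))$ are an approximate identity at \<open>a\<close>: rescaling moves the
  factor \<open>n\<close> into the argument of \<open>f\<close>, and $H'$ has integral $H(1) - H(0) = 1$.\<close>

lemma approximate_identity_limit:
  fixes f :: "real \<Rightarrow> real"
  assumes f: "continuous_on UNIV f" and H: "smooth H"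
    and H0: "\<And>x. x \<le> 0 \<Longrightarrow> H x = 0" and H1: "\<And>x. x \<ge> 1 \<Longrightarrow> H x = 1"
  shows "(\<lambda>n. LINT x|lebesgue. f x * (real (Suc n) * deriv H (real (Suc n) * (x - a)))) \<longlonglongrightarrow> f a"
proof -
  define \<eta> where "\<eta> = deriv H"
  have sm: "smooth \<eta>" and dH: "\<And>x. (H has_real_derivative \<eta> x) (at x)"
    using H by (auto simp: \<eta>_def smooth_deriv smooth_has_derivative)
  have z: "\<eta> x = 0" if "x \<notin> {0..1}" for x
    unfolding \<eta>_def using smooth_step_deriv_test_function(2)[OF H H0 H1 that] by simp
  have ind: "indicator {0..1} x *\<^sub>R \<eta> x = \<eta> x" for x
    using z[of x] by (cases "x \<in> {0..1}") auto
  have int: "integrable lebesgue \<eta>"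
    using borel_integrable_atLeastAtMost'[OF smooth_continuous_on[OF sm], of 0 1]
    unfolding set_integrable_def ind
    by (simp add: integrable_completion smooth_measurable[OF sm])
  have one: "(LINT x|lebesgue. \<eta> x) = 1"
  proof -
    have "(LINT x|lborel. indicator {0..1} x *\<^sub>R \<eta> x) = H 1 - H 0"
      by (rule integral_FTC_atLeastAtMost)
         (auto intro!: smooth_continuous_on[OF sm] has_vector_derivative_at_within dH[THEN has_real_derivative_iff_has_vector_derivative[THEN iffD1]])
    then show ?thesis
      using H0[of 0] H1[of 1] unfolding ind
      by (simp add: integral_completion smooth_measurable[OF sm])
  qed
  have subst: "(LINT x|lebesgue. f x * (real (Suc n) * \<eta> (real (Suc n) * (x - a))))
      = (LINT s|lebesgue. f (a + (1 / real (Suc n)) * s) * \<eta> s)" for n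
    by (subst lebesgue_integral_real_affine[where c = "1 / real (Suc n)" and t = a])
       (simp_all add: field_simps del: of_nat_Suc flip: Bochner_Integration.integral_mult_right_zero)
  obtain B where B: "\<And>x. x \<in> {a..a+1} \<Longrightarrow> \<bar>f x\<bar> \<le> B"
    using continuous_on_Icc_bounded[OF continuous_on_subset[OF f subset_UNIV]] by blast
  have "(\<lambda>n. LINT s|lebesgue. f (a + (1 / real (Suc n)) * s) * \<eta> s) \<longlonglongrightarrow> (LINT s|lebesgue. f a * \<eta> s)"
  proof (rule integral_dominated_convergence[where w = "\<lambda>s. B * \<bar>\<eta> s\<bar>"])
    show "(\<lambda>s. f a * \<eta> s) \<in> borel_measurable lebesgue"
      using int by measurable
    have "continuous_on UNIV (\<lambda>s. f (a + (1 / real (Suc n)) * s))" for n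
      by (intro continuous_on_compose2[OF f] continuous_intros) auto
    then show "(\<lambda>s. f (a + (1 / real (Suc n)) * s) * \<eta> s) \<in> borel_measurable lebesgue" for n
      by (intro borel_measurable_times continuous_measurable_lebesgue borel_measurable_integrable[OF int])
    show "integrable lebesgue (\<lambda>s. B * \<bar>\<eta> s\<bar>)"
      using int by auto
    have "(\<lambda>n. f (a + (1 / real (Suc n)) * s)) \<longlonglongrightarrow> f (a + 0 * s)" for s
    proof (rule isCont_tendsto_compose[of _ f])
      show "isCont f (a + 0 * s)"
        using f by (simp add: continuous_on_eq_continuous_at)
      have "(\<lambda>n. 1 / real (Suc n)) \<longlonglongrightarrow> 0"
        using LIMSEQ_inverse_real_of_nat by (simp add: inverse_eq_divide)
      then show "(\<lambda>n. a + (1 / real (Suc n)) * s) \<longlonglongrightarrow> a + 0 * s"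
        by (intro tendsto_intros)
    qed
    then show "AE s in lebesgue. (\<lambda>n. f (a + (1 / real (Suc n)) * s) * \<eta> s) \<longlonglongrightarrow> f a * \<eta> s"
      by (intro always_eventually allI tendsto_intros) simp
    show "AE s in lebesgue. norm (f (a + (1 / real (Suc n)) * s) * \<eta> s) \<le> B * \<bar>\<eta> s\<bar>" for n
    proof (intro always_eventually allI)
      fix s
      show "norm (f (a + (1 / real (Suc n)) * s) * \<eta> s) \<le> B * \<bar>\<eta> s\<bar>"
      proof (cases "s \<in> {0..1}")
        case True
        then have "a + (1 / real (Suc n)) * s \<in> {a..a+1}"
          by (auto simp: field_simps)
        from B[OF this] show ?thesis
          by (simp add: abs_mult mult_right_mono)
      qed (simp add: z)
    qed
  qed
  then show ?thesis
    using one unfolding subst[symmetric] by (simp add: \<eta>_def)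
qed

text \<open>The test functions $H(n(x - a)) - H(n(x - b))$ converge boundedly to the indicator function of
  $(a, b]$, while their derivatives are the difference of approximate identities at \<open>a\<close> and
  at \<open>b\<close>. Both sides of the definition of the weak derivative then converge.\<close>

lemma weak_derivative_FTC:
  assumes f: "continuous_on UNIV f" and wd: "has_weak_derivative f d" and ab: "a \<le> b"
  shows "(LINT x|lebesgue. indicator {a..b} x * d x) = f b - f a"
proof -
  obtain H :: "real \<Rightarrow> real" where H: "smooth H"
    "\<And>x. x \<le> 0 \<Longrightarrow> H x = 0" "\<And>x. x \<ge> 1 \<Longrightarrow> H x = 1" "\<And>x. 0 \<le> H x" "\<And>x. H x \<le> 1"
    by (rule smooth_step_exists) (rule that)
  have ld: "locally_integrable d" and lf: "locally_integrable f"
    using wd by (auto simp: has_weak_derivative_def)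
  define N where "N n = real (Suc n)" for n
  have N: "N n \<ge> 1" for n by (simp add: N_def)
  define \<phi> where "\<phi> n x = H (- (N n * a) + N n * x) - H (- (N n * b) + N n * x)" for n x
  have sm: "smooth (\<phi> n)" for n
    unfolding \<phi>_def[abs_def] by (intro smooth_diff smooth_affine H)
  have z: "\<phi> n x = 0" if "x \<notin> {a..b+1}" for n x
  proof -
    have "x < a \<or> b + 1 < x" using that by auto
    then show ?thesis
    proof
      assume "x < a"
      then have "N n * x \<le> N n * a" "N n * x \<le> N n * b"
        using N[of n] ab by (auto intro!: mult_left_mono)
      then show ?thesis by (simp add: \<phi>_def H)
    next
      assume "b + 1 < x"
      then have "N n * (x - a) \<ge> 1 * 1" "N n * (x - b) \<ge> 1 * 1"
        using N[of n] ab by (intro mult_mono; linarith)+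
      then show ?thesis by (simp add: \<phi>_def H algebra_simps)
    qed
  qed
  have test: "test_function (\<phi> n)" for n
    by (rule test_functionI[OF sm z])
  have d\<phi>: "deriv (\<phi> n) x = N n * deriv H (N n * (x - a)) - N n * deriv H (N n * (x - b))" for n x
  proof (rule DERIV_imp_deriv)
    have *: "((\<lambda>x. H (- (N n * c) + N n * x)) has_real_derivative N n * deriv H (N n * (x - c))) (at x)" for c
    proof -
      have "((\<lambda>x. - (N n * c) + N n * x) has_real_derivative N n) (at x)"
        by (auto intro!: derivative_eq_intros)
      from DERIV_chain2[OF smooth_has_derivative[OF H(1)] this] show ?thesis
        by (simp add: algebra_simps)
    qed
    show "(\<phi> n has_real_derivative N n * deriv H (N n * (x - a)) - N n * deriv H (N n * (x - b))) (at x)"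
      unfolding \<phi>_def[abs_def] by (intro DERIV_diff *)
  qed
  have "(\<lambda>n. LINT x|lebesgue. f x * deriv (\<phi> n) x) \<longlonglongrightarrow> f a - f b"
  proof -
    have split: "(LINT x|lebesgue. f x * deriv (\<phi> n) x)
      = (LINT x|lebesgue. f x * (N n * deriv H (N n * (x - a))))
        - (LINT x|lebesgue. f x * (N n * deriv H (N n * (x - b))))" for n
    proof -
      have i: "integrable lebesgue (\<lambda>x. f x * (N n * deriv H (N n * (x - c))))" for c
      proof -
        have "test_function (\<lambda>x. deriv H (- (N n * c) + N n * x))"
          using N[of n] by (intro test_function_affine smooth_step_deriv_test_function H) auto
        from test_function_integrable(1)[OF this lf]
        have "integrable lebesgue (\<lambda>x. N n * (f x * deriv H (N n * (x - c))))"
          by (intro integrable_mult_right) (simp add: algebra_simps)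
        then show ?thesis by (simp add: mult.left_commute)
      qed
      show ?thesis
        unfolding d\<phi> right_diff_distrib
        using i by (intro Bochner_Integration.integral_diff) (auto simp: algebra_simps)
    qed
    show ?thesis
      unfolding split N_def
      by (intro tendsto_diff approximate_identity_limit f H)
  qed
  moreover have "(\<lambda>n. LINT x|lebesgue. d x * \<phi> n x) \<longlonglongrightarrow> (LINT x|lebesgue. indicator {a<..b} x * d x)"
  proof (rule integral_dominated_convergence[where w = "\<lambda>x. \<bar>indicator {a..b+1} x * d x\<bar>"])
    have i: "integrable lebesgue (\<lambda>x. indicator {a..b+1} x * d x)"
      using ld unfolding locally_integrable_def set_integrable_def by simp
    then show "integrable lebesgue (\<lambda>x. \<bar>indicator {a..b+1} x * d x\<bar>)" by (rule integrable_abs)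
    have "(\<lambda>x. indicator {a<..b} x * (indicator {a..b+1} x * d x)) \<in> borel_measurable lebesgue"
      by (intro borel_measurable_times borel_measurable_indicator borel_measurable_integrable[OF i]) auto
    moreover have "indicator {a<..b} x * (indicator {a..b+1} x * d x) = indicator {a<..b} x * d x" for x
      by (auto simp: indicator_def)
    ultimately show "(\<lambda>x. indicator {a<..b} x * d x) \<in> borel_measurable lebesgue" by simp
    show "(\<lambda>x. d x * \<phi> n x) \<in> borel_measurable lebesgue" for n
      using test_function_integrable(1)[OF test ld] by auto
    show "AE x in lebesgue. norm (d x * \<phi> n x) \<le> \<bar>indicator {a..b+1} x * d x\<bar>" for n
    proof (intro always_eventually allI)
      fix x
      have "\<bar>\<phi> n x\<bar> \<le> 1"
        using H(4,5)[of "- (N n * a) + N n * x"] H(4,5)[of "- (N n * b) + N n * x"]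
        unfolding \<phi>_def by linarith
      then show "norm (d x * \<phi> n x) \<le> \<bar>indicator {a..b+1} x * d x\<bar>"
        using z[of x n] by (cases "x \<in> {a..b+1}") (auto simp: abs_mult mult_left_le)
    qed
    have "(\<lambda>n. H (- (N n * c) + N n * x)) \<longlonglongrightarrow> (if c < x then 1 else 0)" for c x
    proof (cases "c < x")
      case True
      obtain n0 where n0: "1 / (x - c) < real n0"
        using reals_Archimedean2 by blast
      have "H (- (N n * c) + N n * x) = 1" if "n \<ge> n0" for n
      proof (rule H)
        have "1 / (x - c) \<le> N n"
          using n0 that by (simp add: N_def)
        then show "1 \<le> - (N n * c) + N n * x"
          using True by (simp add: field_simps)
      qed
      then show ?thesis
        using True by (intro tendsto_eventually) (auto simp: eventually_sequentially)
    next
      case False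
      then have "N n * x \<le> N n * c" for n
        using N[of n] by (intro mult_left_mono) auto
      then show ?thesis
        using False by (simp add: H)
    qed
    then have "(\<lambda>n. d x * \<phi> n x) \<longlonglongrightarrow> d x * ((if a < x then 1 else 0) - (if b < x then 1 else 0))" for x
      unfolding \<phi>_def by (intro tendsto_intros)
    moreover have "d x * ((if a < x then 1 else 0) - (if b < x then 1 else 0)) = indicator {a<..b} x * d x" for x
      using ab by (auto simp: indicator_def)
    ultimately show "AE x in lebesgue. (\<lambda>n. d x * \<phi> n x) \<longlonglongrightarrow> indicator {a<..b} x * d x"
      by simp
  qed
  moreover have "(LINT x|lebesgue. f x * deriv (\<phi> n) x) = - (LINT x|lebesgue. d x * \<phi> n x)" for n
    using wd test by (auto simp: has_weak_derivative_def)
  ultimately have lim: "(\<lambda>n. LINT x|lebesgue. d x * \<phi> n x) \<longlonglongrightarrow> (LINT x|lebesgue. indicator {a<..b} x * d x)"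
      "(\<lambda>n. - (LINT x|lebesgue. d x * \<phi> n x)) \<longlonglongrightarrow> f a - f b"
    by simp_all
  have "f a - f b = - (LINT x|lebesgue. indicator {a<..b} x * d x)"
    by (rule LIMSEQ_unique[OF lim(2) tendsto_minus[OF lim(1)]])
  moreover have "(LINT x|lebesgue. indicator {a<..b} x * d x) = (LINT x|lebesgue. indicator {a..b} x * d x)"
  proof (rule integral_cong_AE)
    have i: "(\<lambda>x. indicator {a..b} x * d x) \<in> borel_measurable lebesgue"
      using ld[unfolded locally_integrable_def set_integrable_def, rule_format, of a b]
      by (simp add: borel_measurable_integrable)
    then show "(\<lambda>x. indicator {a..b} x * d x) \<in> borel_measurable lebesgue" .
    have "(\<lambda>x. indicator {a<..b} x * (indicator {a..b} x * d x)) \<in> borel_measurable lebesgue"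
      by (intro borel_measurable_times borel_measurable_indicator i) auto
    moreover have "indicator {a<..b} x * (indicator {a..b} x * d x) = indicator {a<..b} x * d x" for x
      by (auto simp: indicator_def)
    ultimately show "(\<lambda>x. indicator {a<..b} x * d x) \<in> borel_measurable lebesgue" by simp
    have "AE x in lebesgue. x \<noteq> a"
      by (intro AE_completion AE_lborel_singleton)
    then show "AE x in lebesgue. indicator {a<..b} x * d x = indicator {a..b} x * d x"
      by eventually_elim (auto simp: indicator_def)
  qed
  ultimately show ?thesis by simp
qed

section \<open>Square integrable functions\<close>

lemma L2D:
  assumes "f \<in> L2"
  shows "f \<in> borel_measurable lebesgue" "integrable lebesgue (\<lambda>x. (f x)\<^sup>2)"
  using assms by (auto simp: L2_def)

lemma L2_norm_nonneg [simp]: "0 \<le> L2_norm f"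
  by (simp add: L2_norm_def)

lemma L2_norm_power2: "(L2_norm f)\<^sup>2 = (LINT x|lebesgue. (f x)\<^sup>2)"
  by (simp add: L2_norm_def)

lemma L2_norm_zero [simp]: "L2_norm (\<lambda>x. 0) = 0"
  by (simp add: L2_norm_def)

lemma L2_mult_integrable:
  assumes "f \<in> L2" "g \<in> L2"
  shows "integrable lebesgue (\<lambda>x. f x * g x)"
proof (rule Bochner_Integration.integrable_bound)
  show "integrable lebesgue (\<lambda>x. (f x)\<^sup>2 + (g x)\<^sup>2)"
    using assms by (intro Bochner_Integration.integrable_add L2D)
  show "(\<lambda>x. f x * g x) \<in> borel_measurable lebesgue"
    using assms by (intro borel_measurable_times L2D)
  have "\<bar>a * b\<bar> \<le> a\<^sup>2 + b\<^sup>2" for a b :: real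
  proof -
    have "2 * (\<bar>a\<bar> * \<bar>b\<bar>) \<le> a\<^sup>2 + b\<^sup>2"
      using sum_squares_bound[of "\<bar>a\<bar>" "\<bar>b\<bar>"] by simp
    moreover have "0 \<le> \<bar>a\<bar> * \<bar>b\<bar>" by simp
    ultimately show ?thesis unfolding abs_mult by linarith
  qed
  then show "AE x in lebesgue. norm (f x * g x) \<le> norm ((f x)\<^sup>2 + (g x)\<^sup>2)"
    by simp
qed

lemma L2_cong_AE:
  assumes "f \<in> L2" "g \<in> borel_measurable lebesgue" "AE x in lebesgue. f x = g x"
  shows "g \<in> L2" and "L2_norm g = L2_norm f"
proof -
  have ae: "AE x in lebesgue. (f x)\<^sup>2 = (g x)\<^sup>2"
    using assms(3) by eventually_elim simp
  have m: "(\<lambda>x. (f x)\<^sup>2) \<in> borel_measurable lebesgue" "(\<lambda>x. (g x)\<^sup>2) \<in> borel_measurable lebesgue"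
    using L2D(1)[OF assms(1)] assms(2) by (auto intro: borel_measurable_power)
  have "integrable lebesgue (\<lambda>x. (g x)\<^sup>2)"
    using integrable_cong_AE[OF m ae] L2D(2)[OF assms(1)] by simp
  then show "g \<in> L2" using assms(2) by (simp add: L2_def)
  show "L2_norm g = L2_norm f"
    unfolding L2_norm_def using integral_cong_AE[OF m ae] by simp
qed

lemma L2_cmult:
  assumes "f \<in> L2"
  shows "(\<lambda>x. c * f x) \<in> L2" "L2_norm (\<lambda>x. c * f x) = \<bar>c\<bar> * L2_norm f"
  using L2D[OF assms] by (auto simp: L2_def L2_norm_def power_mult_distrib real_sqrt_mult)

lemma L2_add:
  assumes "f \<in> L2" "g \<in> L2"
  shows "(\<lambda>x. f x + g x) \<in> L2"
  using L2D[OF assms(1)] L2D[OF assms(2)] L2_mult_integrable[OF assms]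
  by (auto simp: L2_def power2_sum mult.assoc)

lemma L2_diff:
  assumes "f \<in> L2" "g \<in> L2"
  shows "(\<lambda>x. f x - g x) \<in> L2"
  using L2_add[OF assms(1) L2_cmult(1)[OF assms(2), of "-1"]] by simp

lemma L2_mono:
  assumes "f \<in> L2" "g \<in> borel_measurable lebesgue" "\<And>x. \<bar>g x\<bar> \<le> C * \<bar>f x\<bar>"
  shows "g \<in> L2" "L2_norm g \<le> \<bar>C\<bar> * L2_norm f"
proof -
  have le: "(g x)\<^sup>2 \<le> C\<^sup>2 * (f x)\<^sup>2" for x
    using power_mono[OF assms(3), of x 2] by (simp add: power_mult_distrib)
  have i: "integrable lebesgue (\<lambda>x. C\<^sup>2 * (f x)\<^sup>2)"
    using L2D(2)[OF assms(1)] by simp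
  have ig: "integrable lebesgue (\<lambda>x. (g x)\<^sup>2)"
    by (rule Bochner_Integration.integrable_bound[OF i]) (use le assms(2) in auto)
  then show "g \<in> L2" using assms(2) by (simp add: L2_def)
  have "(LINT x|lebesgue. (g x)\<^sup>2) \<le> (LINT x|lebesgue. C\<^sup>2 * (f x)\<^sup>2)"
    by (rule integral_mono[OF ig i le])
  then have "L2_norm g \<le> sqrt (C\<^sup>2 * (LINT x|lebesgue. (f x)\<^sup>2))"
    unfolding L2_norm_def by simp
  then show "L2_norm g \<le> \<bar>C\<bar> * L2_norm f"
    by (simp add: L2_norm_def real_sqrt_mult)
qed

lemma L2_Cauchy_Schwarz:
  assumes "f \<in> L2" "g \<in> L2"
  shows "\<bar>LINT x|lebesgue. f x * g x\<bar> \<le> L2_norm f * L2_norm g"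
proof -
  define A B C where "A = (LINT x|lebesgue. (f x)\<^sup>2)" and "B = (LINT x|lebesgue. (g x)\<^sup>2)"
    and "C = (LINT x|lebesgue. f x * g x)"
  note i = L2D(2)[OF assms(1)] L2D(2)[OF assms(2)] L2_mult_integrable[OF assms]
  \<comment> \<open>The quadratic form of \<open>f\<close> and \<open>g\<close> in both coefficients, so that a vanishing
    norm of either function needs no division.\<close>
  have *: "0 \<le> s\<^sup>2 * A + 2 * s * t * C + t\<^sup>2 * B" for s t
  proof -
    have "0 \<le> (LINT x|lebesgue. (s * f x + t * g x)\<^sup>2)" by simp
    also have "(\<lambda>x. (s * f x + t * g x)\<^sup>2) = (\<lambda>x. s\<^sup>2 * (f x)\<^sup>2 + (2 * s * t) * (f x * g x) + t\<^sup>2 * (g x)\<^sup>2)"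
      by (auto simp: power2_eq_square algebra_simps)
    also have "(LINT x|lebesgue. s\<^sup>2 * (f x)\<^sup>2 + (2 * s * t) * (f x * g x) + t\<^sup>2 * (g x)\<^sup>2)
       = s\<^sup>2 * A + (2 * s * t) * C + t\<^sup>2 * B"
      unfolding A_def B_def C_def using i by simp
    finally show ?thesis .
  qed
  have AB: "0 \<le> A" "0 \<le> B" by (simp_all add: A_def B_def)
  have "C\<^sup>2 \<le> A * B"
  proof (cases "B = 0")
    case True
    then have "0 \<le> A + 2 * t * C" for t using *[of 1 t] by simp
    from this[of "- (A + 1) / (2 * C)"] have "C = 0" by (cases "C = 0") (auto simp: field_simps)
    then show ?thesis using True by simp
  next
    case False
    have "0 \<le> B * (A * B - C\<^sup>2)"
      using *[of B "- C"] by (simp add: power2_eq_square algebra_simps)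
    with False AB show ?thesis
      by (simp add: zero_le_mult_iff)
  qed
  then have "sqrt (C\<^sup>2) \<le> sqrt (A * B)" by (rule real_sqrt_le_mono)
  then show ?thesis by (simp add: A_def B_def C_def L2_norm_def real_sqrt_mult)
qed

lemma L2_norm_triangle:
  assumes "f \<in> L2" "g \<in> L2"
  shows "L2_norm (\<lambda>x. f x + g x) \<le> L2_norm f + L2_norm g"
proof (rule power2_le_imp_le)
  note i = L2D(2)[OF assms(1)] L2D(2)[OF assms(2)] L2_mult_integrable[OF assms]
  have "(L2_norm (\<lambda>x. f x + g x))\<^sup>2 = (LINT x|lebesgue. (f x)\<^sup>2 + (g x)\<^sup>2 + 2 * (f x * g x))"
    by (simp add: L2_norm_power2 power2_sum mult.assoc)
  also have "\<dots> = (L2_norm f)\<^sup>2 + (L2_norm g)\<^sup>2 + 2 * (LINT x|lebesgue. f x * g x)"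
    using i by (simp add: L2_norm_power2)
  also have "\<dots> \<le> (L2_norm f + L2_norm g)\<^sup>2"
    using L2_Cauchy_Schwarz[OF assms] by (simp add: power2_sum)
  finally show "(L2_norm (\<lambda>x. f x + g x))\<^sup>2 \<le> (L2_norm f + L2_norm g)\<^sup>2" .
qed simp

lemma L2_locally_integrable:
  assumes "f \<in> L2"
  shows "locally_integrable f"
  unfolding locally_integrable_def set_integrable_def
proof (intro allI)
  fix a b :: real
  show "integrable lebesgue (\<lambda>x. indicator {a..b} x *\<^sub>R f x)"
  proof (rule Bochner_Integration.integrable_bound)
    show "integrable lebesgue (\<lambda>x. indicator {a..b} x + (f x)\<^sup>2)"
      using L2D(2)[OF assms]
      by (intro Bochner_Integration.integrable_add integrable_real_indicator)
         (auto simp: emeasure_lborel_Icc_eq)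
    show "(\<lambda>x. indicator {a..b} x *\<^sub>R f x) \<in> borel_measurable lebesgue"
      using L2D(1)[OF assms] by (intro borel_measurable_scaleR borel_measurable_indicator) auto
    have "\<bar>y\<bar> \<le> 1 + y\<^sup>2" for y :: real
      using sum_squares_bound[of "\<bar>y\<bar>" 1] by simp
    then show "AE x in lebesgue. norm (indicator {a..b} x *\<^sub>R f x) \<le> norm (indicator {a..b} x + (f x)\<^sup>2)"
      by (auto simp: indicator_def)
  qed
qed

lemma L2_norm_eq_nn_integral:
  assumes "f \<in> L2"
  shows "(\<integral>\<^sup>+x. ennreal ((f x)\<^sup>2) \<partial>lebesgue) = ennreal ((L2_norm f)\<^sup>2)"
  unfolding L2_norm_power2 by (rule nn_integral_eq_integral[OF L2D(2)[OF assms]]) simp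

lemma L2I_nn_integral:
  assumes "f \<in> borel_measurable lebesgue" "(\<integral>\<^sup>+x. ennreal ((f x)\<^sup>2) \<partial>lebesgue) \<le> ennreal (C\<^sup>2)" "0 \<le> C"
  shows "f \<in> L2" "L2_norm f \<le> C"
proof -
  have m: "(\<lambda>x. (f x)\<^sup>2) \<in> borel_measurable lebesgue" using assms(1) by measurable
  have "integrable lebesgue (\<lambda>x. (f x)\<^sup>2)"
    by (rule integrableI_bounded[OF m]) (use assms(2) in \<open>auto simp: le_less_trans[OF _ ennreal_less_top]\<close>)
  then show f: "f \<in> L2" using assms(1) by (simp add: L2_def)
  have "ennreal ((L2_norm f)\<^sup>2) \<le> ennreal (C\<^sup>2)"
    using assms(2) L2_norm_eq_nn_integral[OF f] by simp
  then have "(L2_norm f)\<^sup>2 \<le> C\<^sup>2" by simp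
  then show "L2_norm f \<le> C" using assms(3) by (rule power2_le_imp_le)
qed

text \<open>The Riesz-Fischer theorem in the form that a fixed point iteration needs. Since the successive
  differences $d_n$ satisfy $\int d_n^2 / q^n \le C^2 q^n$, the series of $d_n^2 / q^n$ is integrable and
  hence finite almost everywhere. There the bound $2 |d_n| \le q^n + d_n^2 / q^n$ makes the sequence
  converge, and Fatou's lemma turns pointwise convergence into convergence of norms.\<close>

lemma L2_complete_geometric:
  assumes F: "\<And>n. F n \<in> L2" and q: "0 < q" "q < 1" and C: "0 \<le> C"
    and step: "\<And>n. L2_norm (\<lambda>x. F (Suc n) x - F n x) \<le> C * q ^ n"
  obtains f where "f \<in> L2" "(\<lambda>n. L2_norm (\<lambda>x. F n x - f x)) \<longlonglongrightarrow> 0"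
    "AE x in lebesgue. (\<lambda>n. F n x) \<longlonglongrightarrow> f x"
proof -
  define d where "d n x = F (Suc n) x - F n x" for n x
  have d: "d n \<in> L2" for n unfolding d_def[abs_def] by (intro L2_diff F)
  have [measurable]: "d n \<in> borel_measurable lebesgue" "F n \<in> borel_measurable lebesgue" for n
    using L2D(1) d F by auto
  have int: "(\<integral>\<^sup>+x. ennreal ((d n x)\<^sup>2 / q ^ n) \<partial>lebesgue) \<le> ennreal (C\<^sup>2 * q ^ n)" for n
  proof -
    have "(\<integral>\<^sup>+x. ennreal ((d n x)\<^sup>2 / q ^ n) \<partial>lebesgue) = ennreal ((L2_norm (d n))\<^sup>2 / q ^ n)"
      unfolding L2_norm_power2
      using nn_integral_eq_integral[of lebesgue "\<lambda>x. (d n x)\<^sup>2 / q ^ n"] L2D(2)[OF d[of n]] q by simp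
    also have "(L2_norm (d n))\<^sup>2 / q ^ n \<le> (C * q ^ n)\<^sup>2 / q ^ n"
      using step[of n] q by (intro divide_right_mono power_mono) (auto simp: d_def[abs_def])
    also have "\<dots> = C\<^sup>2 * q ^ n"
      using q by (simp add: power2_eq_square)
    finally show ?thesis by (simp add: ennreal_leI)
  qed
  have "(\<integral>\<^sup>+x. (\<Sum>n. ennreal ((d n x)\<^sup>2 / q ^ n)) \<partial>lebesgue)
      = (\<Sum>n. \<integral>\<^sup>+x. ennreal ((d n x)\<^sup>2 / q ^ n) \<partial>lebesgue)"
    by (rule nn_integral_suminf) measurable
  also have "\<dots> \<le> (\<Sum>n. ennreal (C\<^sup>2 * q ^ n))"
    by (intro suminf_le int) auto
  also have "\<dots> < \<infinity>"
  proof -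
    have "summable (\<lambda>n. C\<^sup>2 * q ^ n)"
      using q by (intro summable_mult summable_geometric) auto
    then have "(\<Sum>n. ennreal (C\<^sup>2 * q ^ n)) = ennreal (\<Sum>n. C\<^sup>2 * q ^ n)"
      using q by (intro suminf_ennreal2) auto
    then show ?thesis by simp
  qed
  finally have fin: "(\<integral>\<^sup>+x. (\<Sum>n. ennreal ((d n x)\<^sup>2 / q ^ n)) \<partial>lebesgue) \<noteq> \<infinity>" by simp
  have "AE x in lebesgue. (\<Sum>n. ennreal ((d n x)\<^sup>2 / q ^ n)) \<noteq> \<infinity>"
    by (rule nn_integral_PInf_AE[OF _ fin]) measurable
  then have conv: "AE x in lebesgue. convergent (\<lambda>n. F n x)"
  proof eventually_elim
    case (elim x)
    have "summable (\<lambda>n. (d n x)\<^sup>2 / q ^ n)"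
      using elim q by (intro summable_suminf_not_top) auto
    then have s: "summable (\<lambda>n. q ^ n + (d n x)\<^sup>2 / q ^ n)"
      using q by (intro summable_add summable_geometric) auto
    have "summable (\<lambda>n. d n x)"
    proof (rule summable_comparison_test'[OF s])
      fix n
      have "\<bar>d n x\<bar> * q ^ n * 1 \<le> \<bar>d n x\<bar> * q ^ n * 2"
        using q by (intro mult_left_mono) auto
      also have "\<dots> \<le> (q ^ n)\<^sup>2 + (d n x)\<^sup>2"
        using sum_squares_bound[of "q ^ n" "\<bar>d n x\<bar>"] by (simp add: mult_ac)
      finally show "norm (d n x) \<le> q ^ n + (d n x)\<^sup>2 / q ^ n"
        using q by (simp add: field_simps power2_eq_square)
    qed
    then have "convergent (\<lambda>n. \<Sum>i<n. d i x)"
      by (simp add: summable_iff_convergent)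
    moreover have "(\<Sum>i<n. d i x) = F n x - F 0 x" for n
      unfolding d_def by (rule sum_lessThan_telescope)
    ultimately have "convergent (\<lambda>n. (F n x - F 0 x) + F 0 x)"
      by (intro convergent_add convergent_const) auto
    then show ?case by simp
  qed
  define f where "f x = lim (\<lambda>n. F n x)" for x
  have [measurable]: "f \<in> borel_measurable lebesgue"
    unfolding f_def[abs_def] by measurable
  have lim: "AE x in lebesgue. (\<lambda>n. F n x) \<longlonglongrightarrow> f x"
    using conv by eventually_elim (simp add: f_def convergent_LIMSEQ_iff)
  have dist: "L2_norm (\<lambda>x. F (n + k) x - F n x) \<le> C / (1 - q) * q ^ n" for n k
  proof -
    have "L2_norm (\<lambda>x. F (n + k) x - F n x) \<le> (\<Sum>i<k. C * q ^ (n + i))"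
    proof (induction k)
      case (Suc k)
      have "L2_norm (\<lambda>x. F (n + Suc k) x - F n x) = L2_norm (\<lambda>x. d (n + k) x + (F (n + k) x - F n x))"
        by (simp add: d_def)
      also have "\<dots> \<le> L2_norm (d (n + k)) + L2_norm (\<lambda>x. F (n + k) x - F n x)"
        by (intro L2_norm_triangle d L2_diff F)
      also have "\<dots> \<le> C * q ^ (n + k) + (\<Sum>i<k. C * q ^ (n + i))"
        using step[of "n + k"] Suc by (simp add: d_def[abs_def])
      finally show ?case by simp
    qed simp
    also have "\<dots> = C * q ^ n * (\<Sum>i<k. q ^ i)"
      by (simp add: sum_distrib_left power_add mult.assoc)
    also have "\<dots> \<le> C * q ^ n * (1 / (1 - q))"
    proof (rule mult_left_mono)
      show "(\<Sum>i<k. q ^ i) \<le> 1 / (1 - q)"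
        using q by (subst sum_gp_strict) (auto simp: divide_right_mono)
    qed (use q C in auto)
    finally show ?thesis by (simp add: field_simps)
  qed
  have fdist: "(\<lambda>x. f x - F n x) \<in> L2 \<and> L2_norm (\<lambda>x. f x - F n x) \<le> C / (1 - q) * q ^ n" for n
  proof -
    let ?r = "C / (1 - q) * q ^ n"
    have r: "0 \<le> ?r" using q C by simp
    have "(\<integral>\<^sup>+x. ennreal ((f x - F n x)\<^sup>2) \<partial>lebesgue)
        = (\<integral>\<^sup>+x. liminf (\<lambda>k. ennreal ((F (n + k) x - F n x)\<^sup>2)) \<partial>lebesgue)"
    proof (rule nn_integral_cong_AE)
      show "AE x in lebesgue. ennreal ((f x - F n x)\<^sup>2) = liminf (\<lambda>k. ennreal ((F (n + k) x - F n x)\<^sup>2))"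
        using lim
      proof eventually_elim
        case (elim x)
        have "(\<lambda>k. F (n + k) x) \<longlonglongrightarrow> f x"
          using LIMSEQ_ignore_initial_segment[OF elim, of n] by (simp add: add.commute)
        then have "(\<lambda>k. ennreal ((F (n + k) x - F n x)\<^sup>2)) \<longlonglongrightarrow> ennreal ((f x - F n x)\<^sup>2)"
          by (intro tendsto_ennrealI tendsto_intros)
        then show ?case
          by (intro lim_imp_Liminf[symmetric]) simp
      qed
    qed
    also have "\<dots> \<le> liminf (\<lambda>k. \<integral>\<^sup>+x. ennreal ((F (n + k) x - F n x)\<^sup>2) \<partial>lebesgue)"
      by (rule nn_integral_liminf) measurable
    also have "\<dots> \<le> liminf (\<lambda>k. ennreal (?r\<^sup>2))"
    proof (intro Liminf_mono always_eventually allI)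
      fix k
      show "(\<integral>\<^sup>+x. ennreal ((F (n + k) x - F n x)\<^sup>2) \<partial>lebesgue) \<le> ennreal (?r\<^sup>2)"
        by (subst L2_norm_eq_nn_integral[OF L2_diff[OF F F]])
           (intro ennreal_leI power_mono dist, simp)
    qed
    also have "\<dots> = ennreal (?r\<^sup>2)"
      by (simp add: Liminf_const)
    finally have le: "(\<integral>\<^sup>+x. ennreal ((f x - F n x)\<^sup>2) \<partial>lebesgue) \<le> ennreal (?r\<^sup>2)" .
    have m: "(\<lambda>x. f x - F n x) \<in> borel_measurable lebesgue" by measurable
    show ?thesis
      using L2I_nn_integral[OF m le r] by blast
  qed
  have fL2: "f \<in> L2"
    using L2_add[OF conjunct1[OF fdist[of 0]] F[of 0]] by simp
  have "(\<lambda>n. L2_norm (\<lambda>x. F n x - f x)) \<longlonglongrightarrow> 0"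
  proof (rule tendsto_sandwich[of "\<lambda>_. 0"])
    have "L2_norm (\<lambda>x. F n x - f x) \<le> C / (1 - q) * q ^ n" for n
      using fdist[of n] by (simp add: L2_norm_def power2_commute)
    then show "eventually (\<lambda>n. L2_norm (\<lambda>x. F n x - f x) \<le> C / (1 - q) * q ^ n) sequentially"
      by simp
    show "(\<lambda>n. C / (1 - q) * q ^ n) \<longlonglongrightarrow> 0"
      using q by (intro tendsto_mult_right_zero LIMSEQ_realpow_zero) auto
  qed auto
  then show ?thesis
    by (rule that[OF fL2 _ lim])
qed

section \<open>Uniqueness of weak derivatives\<close>

lemma locally_integrable_measurable:
  assumes "locally_integrable h"
  shows "h \<in> borel_measurable lebesgue"
proof (rule borel_measurable_LIMSEQ_real)
  fix x :: real
  have "indicator {- real n..real n} x * h x = h x" if "n \<ge> nat \<lceil>\<bar>x\<bar>\<rceil>" for n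
    using that by (auto simp: indicator_def abs_le_iff nat_le_iff ceiling_le_iff)
  then show "(\<lambda>n. indicator {- real n..real n} x * h x) \<longlonglongrightarrow> h x"
    by (intro tendsto_eventually eventually_sequentiallyI)
next
  show "(\<lambda>x. indicator {- real n..real n} x * h x) \<in> borel_measurable lebesgue" for n
    using assms unfolding locally_integrable_def set_integrable_def
    by (simp add: borel_measurable_integrable)
qed

text \<open>The positive and the negative part of \<open>k\<close> are densities of two finite measures that agree
  on all half-lines, hence are equal.\<close>

lemma AE_zero_if_halfline_integrals_zero:
  fixes k :: "real \<Rightarrow> real"
  assumes k: "integrable lborel k"
    and z: "\<And>x. (LINT t|lborel. indicator {x<..} t * k t) = 0"
  shows "AE x in lborel. k x = 0"
proof -
  have [measurable]: "k \<in> borel_measurable borel"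
    using k by (simp add: borel_measurable_integrable flip: measurable_lborel1)
  define p m where "p t = max 0 (k t)" and "m t = max 0 (- k t)" for t
  have [measurable]: "p \<in> borel_measurable borel" "m \<in> borel_measurable borel"
    by (simp_all add: p_def[abs_def] m_def[abs_def])
  have i: "integrable lborel (\<lambda>t. indicator {x<..} t * p t)" "integrable lborel (\<lambda>t. indicator {x<..} t * m t)" for x
    by (rule Bochner_Integration.integrable_bound[OF k]; auto simp: p_def m_def indicator_def intro!: AE_I2)+
  have emeas: "emeasure (density lborel (\<lambda>t. ennreal (h t))) {x<..} = ennreal (LINT t|lborel. indicator {x<..} t * h t)"
    if "h \<in> borel_measurable borel" "\<And>t. h t \<ge> 0" "integrable lborel (\<lambda>t. indicator {x<..} t * h t)" for h :: "real \<Rightarrow> real" and x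
  proof -
    have "emeasure (density lborel (\<lambda>t. ennreal (h t))) {x<..} = (\<integral>\<^sup>+t. ennreal (indicator {x<..} t * h t) \<partial>lborel)"
      using that(1) by (subst emeasure_density) (auto intro!: nn_integral_cong borel_open simp: indicator_def)
    also have "\<dots> = ennreal (LINT t|lborel. indicator {x<..} t * h t)"
      by (rule nn_integral_eq_integral[OF that(3)]) (simp add: that(2))
    finally show ?thesis .
  qed
  have "density lborel (\<lambda>t. ennreal (p t)) = density lborel (\<lambda>t. ennreal (m t))"
  proof (rule measure_eqI_lessThan)
    fix x
    have "(LINT t|lborel. indicator {x<..} t * p t) - (LINT t|lborel. indicator {x<..} t * m t)
      = (LINT t|lborel. indicator {x<..} t * k t)"
      by (subst Bochner_Integration.integral_diff[symmetric, OF i])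
         (auto intro!: Bochner_Integration.integral_cong simp: p_def m_def indicator_def max_def)
    then show "emeasure (density lborel (\<lambda>t. ennreal (p t))) {x<..} = emeasure (density lborel (\<lambda>t. ennreal (m t))) {x<..}"
      by (subst (1 2) emeas) (use i z in \<open>auto simp: p_def m_def\<close>)
    show "emeasure (density lborel (\<lambda>t. ennreal (p t))) {x<..} < \<infinity>"
      by (subst emeas) (use i in \<open>auto simp: p_def\<close>)
  qed simp_all
  then have "AE x in lborel. ennreal (p x) = ennreal (m x)"
    using sigma_finite_measure.density_unique_iff[OF lborel.sigma_finite_measure_axioms,
        of "\<lambda>x. ennreal (p x)" "\<lambda>x. ennreal (m x)"] by simp
  then show ?thesis
    by eventually_elim (auto simp: p_def m_def max_def split: if_splits)
qed

text \<open>Cutting off to $[-n, n]$ makes the function integrable, and a half-line meets $[-n, n]$ in an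
  interval up to a single point.\<close>

lemma AE_zero_if_interval_integrals_zero:
  assumes h: "locally_integrable h"
    and z: "\<And>a b. a \<le> b \<Longrightarrow> (LINT x|lebesgue. indicator {a..b} x * h x) = 0"
  shows "AE x in lebesgue. h x = 0"
proof -
  have "AE x in lebesgue. indicator {- real n..real n} x * h x = 0" for n
  proof -
    define c where "c = (\<lambda>x. indicator {- real n..real n} x * h x)"
    have ic: "integrable lebesgue c"
      using h unfolding locally_integrable_def set_integrable_def c_def by simp
    obtain k where k: "k \<in> borel_measurable lborel" "AE x in lborel. c x = k x"
      using completion_ex_borel_measurable_real[OF borel_measurable_integrable[OF ic]] by blast
    have ae: "AE x in lebesgue. c x = k x" using k(2) by (rule AE_completion)
    have "integrable lebesgue k"
      using integrable_cong_AE[OF borel_measurable_integrable[OF ic] measurable_completion[OF k(1)] ae] ic by simp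
    then have ik: "integrable lborel k" using k(1) by (simp add: integrable_completion)
    have "(LINT t|lborel. indicator {x<..} t * k t) = 0" for x
    proof -
      have "(LINT t|lborel. indicator {x<..} t * k t) = (LINT t|lebesgue. indicator {x<..} t * k t)"
        using k(1) by (intro integral_completion[symmetric]) auto
      also have "\<dots> = (LINT t|lebesgue. indicator {max x (- real n)..real n} t * h t)"
      proof (rule integral_cong_AE)
        have "(\<lambda>t. indicator {x<..} t * k t) \<in> borel_measurable lborel"
          using k(1) by measurable
        then show "(\<lambda>t. indicator {x<..} t * k t) \<in> borel_measurable lebesgue"
          by (rule measurable_completion)
        show "(\<lambda>t. indicator {max x (- real n)..real n} t * h t) \<in> borel_measurable lebesgue"
          using h unfolding locally_integrable_def set_integrable_def
          by (simp add: borel_measurable_integrable)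
        have "AE t in lebesgue. t \<noteq> x"
          by (intro AE_completion AE_lborel_singleton)
        with ae show "AE t in lebesgue. indicator {x<..} t * k t = indicator {max x (- real n)..real n} t * h t"
          by eventually_elim (auto simp: c_def indicator_def)
      qed
      also have "\<dots> = 0"
        using z[of "max x (- real n)" "real n"] by (cases "max x (- real n) \<le> real n") auto
      finally show ?thesis .
    qed
    with ik have "AE x in lborel. k x = 0" by (rule AE_zero_if_halfline_integrals_zero)
    then have "AE x in lebesgue. k x = 0" by (rule AE_completion)
    with ae show ?thesis unfolding c_def by eventually_elim simp
  qed
  then have "AE x in lebesgue. \<forall>n. indicator {- real n..real n} x * h x = 0"
    unfolding AE_all_countable by blast
  then show ?thesis
  proof eventually_elim
    case (elim x)
    obtain n where "\<bar>x\<bar> \<le> real n" using real_arch_simple by blast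
    with elim[rule_format, of n] show ?case by (simp add: indicator_def abs_le_iff split: if_splits)
  qed
qed

lemma locally_integrable_add:
  "locally_integrable f \<Longrightarrow> locally_integrable g \<Longrightarrow> locally_integrable (\<lambda>x. f x + g x)"
  unfolding locally_integrable_def by auto

lemma locally_integrable_cmult:
  "locally_integrable f \<Longrightarrow> locally_integrable (\<lambda>x. c * f x)"
  unfolding locally_integrable_def by auto

lemma weak_derivative_unique:
  assumes "continuous_on UNIV f" "has_weak_derivative f d" "has_weak_derivative f e"
  shows "AE x in lebesgue. d x = e x"
proof -
  have l: "locally_integrable d" "locally_integrable e"
    using assms by (auto simp: has_weak_derivative_def)
  have "AE x in lebesgue. d x + (-1) * e x = 0"
  proof (rule AE_zero_if_interval_integrals_zero)
    show "locally_integrable (\<lambda>x. d x + (-1) * e x)"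
      by (intro locally_integrable_add locally_integrable_cmult l)
    fix a b :: real assume "a \<le> b"
    have i: "integrable lebesgue (\<lambda>x. indicator {a..b} x * d x)" "integrable lebesgue (\<lambda>x. indicator {a..b} x * e x)"
      using l unfolding locally_integrable_def set_integrable_def by auto
    have "(LINT x|lebesgue. indicator {a..b} x * (d x + (-1) * e x))
      = (LINT x|lebesgue. indicator {a..b} x * d x - indicator {a..b} x * e x)"
      by (simp add: algebra_simps)
    also have "\<dots> = (LINT x|lebesgue. indicator {a..b} x * d x) - (LINT x|lebesgue. indicator {a..b} x * e x)"
      by (rule Bochner_Integration.integral_diff[OF i])
    also have "\<dots> = 0"
      using weak_derivative_FTC[OF assms(1,2) \<open>a \<le> b\<close>] weak_derivative_FTC[OF assms(1,3) \<open>a \<le> b\<close>] by simp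
    finally show "(LINT x|lebesgue. indicator {a..b} x * (d x + (-1) * e x)) = 0" .
  qed
  then show ?thesis by eventually_elim simp
qed

section \<open>The space of Sobolev functions\<close>

lemma has_weak_derivative_add:
  assumes "has_weak_derivative f d" "has_weak_derivative g e"
  shows "has_weak_derivative (\<lambda>x. f x + g x) (\<lambda>x. d x + e x)"
proof -
  have l: "locally_integrable f" "locally_integrable d" "locally_integrable g" "locally_integrable e"
    using assms by (auto simp: has_weak_derivative_def)
  moreover have "(LINT x|lebesgue. (f x + g x) * deriv \<phi> x) = - (LINT x|lebesgue. (d x + e x) * \<phi> x)"
    if "test_function \<phi>" for \<phi>
    using assms that test_function_integrable[OF that] l
    by (simp add: has_weak_derivative_def distrib_right)
  ultimately show ?thesis
    by (simp add: has_weak_derivative_def locally_integrable_add)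
qed

lemma has_weak_derivative_cmult:
  assumes "has_weak_derivative f d"
  shows "has_weak_derivative (\<lambda>x. c * f x) (\<lambda>x. c * d x)"
  using assms by (simp add: has_weak_derivative_def locally_integrable_cmult mult.assoc)

lemma H1D:
  assumes "f \<in> H1"
  shows "continuous_on UNIV f" "f \<in> L2" "has_weak_derivative f (weak_deriv f)" "weak_deriv f \<in> L2"
  using assms someI_ex[of "has_weak_derivative f"]
  by (auto simp: H1_def weakly_differentiable_def weak_deriv_def)

text \<open>Any square integrable weak derivative may replace the one that \<open>weak_deriv\<close> chooses.\<close>

lemma H1I:
  assumes "continuous_on UNIV f" "f \<in> L2" "has_weak_derivative f d" "d \<in> L2"
  shows "f \<in> H1" "L2_norm (weak_deriv f) = L2_norm d"
proof -
  have w: "has_weak_derivative f (weak_deriv f)"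
    using assms(3) unfolding weak_deriv_def by (rule someI[where P = "has_weak_derivative f"])
  then have m: "weak_deriv f \<in> borel_measurable lebesgue"
    by (auto simp: has_weak_derivative_def locally_integrable_measurable)
  note L2_cong_AE[OF assms(4) m weak_derivative_unique[OF assms(1,3) w]]
  then show "f \<in> H1" "L2_norm (weak_deriv f) = L2_norm d"
    using assms by (auto simp: H1_def weakly_differentiable_def)
qed

lemma H1_norm_eq:
  assumes "continuous_on UNIV f" "f \<in> L2" "has_weak_derivative f d" "d \<in> L2"
  shows "H1_norm f = sqrt ((L2_norm f)\<^sup>2 + (L2_norm d)\<^sup>2)"
  using H1I[OF assms] by (simp add: H1_norm_def)

lemma H1_norm_nonneg [simp]: "0 \<le> H1_norm f"
  by (simp add: H1_norm_def)

lemma H1_norm_ge_L2_norm: "L2_norm f \<le> H1_norm f" "L2_norm (weak_deriv f) \<le> H1_norm f"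
  by (auto simp: H1_norm_def real_le_rsqrt)

lemma H1_add:
  assumes "f \<in> H1" "g \<in> H1"
  shows "(\<lambda>x. f x + g x) \<in> H1" "H1_norm (\<lambda>x. f x + g x) \<le> H1_norm f + H1_norm g"
proof -
  note f = H1D[OF assms(1)] and g = H1D[OF assms(2)]
  note sum = continuous_on_add[OF f(1) g(1)] L2_add[OF f(2) g(2)]
    has_weak_derivative_add[OF f(3) g(3)] L2_add[OF f(4) g(4)]
  show "(\<lambda>x. f x + g x) \<in> H1" by (rule H1I[OF sum])
  have "H1_norm (\<lambda>x. f x + g x) \<le> sqrt ((L2_norm f + L2_norm g)\<^sup>2 + (L2_norm (weak_deriv f) + L2_norm (weak_deriv g))\<^sup>2)"
    unfolding H1_norm_eq[OF sum]
    by (intro real_sqrt_le_mono add_mono power_mono L2_norm_triangle f g L2_norm_nonneg)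
  also have "\<dots> \<le> H1_norm f + H1_norm g"
    unfolding H1_norm_def by (rule real_sqrt_sum_squares_triangle_ineq)
  finally show "H1_norm (\<lambda>x. f x + g x) \<le> H1_norm f + H1_norm g" .
qed

lemma H1_cmult:
  assumes "f \<in> H1"
  shows "(\<lambda>x. c * f x) \<in> H1" "H1_norm (\<lambda>x. c * f x) = \<bar>c\<bar> * H1_norm f"
proof -
  note f = H1D[OF assms]
  note m = continuous_on_mult_left[OF f(1), of c] L2_cmult(1)[OF f(2), of c]
    has_weak_derivative_cmult[OF f(3), of c] L2_cmult(1)[OF f(4), of c]
  show "(\<lambda>x. c * f x) \<in> H1" by (rule H1I[OF m])
  show "H1_norm (\<lambda>x. c * f x) = \<bar>c\<bar> * H1_norm f"
    unfolding H1_norm_eq[OF m]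
    by (simp add: L2_cmult(2) f power_mult_distrib real_sqrt_mult H1_norm_def flip: distrib_left)
qed

lemma H1_diff:
  assumes "f \<in> H1" "g \<in> H1"
  shows "(\<lambda>x. f x - g x) \<in> H1"
  using H1_add(1)[OF assms(1) H1_cmult(1)[OF assms(2), of "-1"]] by simp

lemma H1_zero: "(\<lambda>x. 0) \<in> H1" "H1_norm (\<lambda>x. 0) = 0"
proof -
  have z: "continuous_on UNIV (\<lambda>x::real. 0::real)" "(\<lambda>x. 0) \<in> L2" "has_weak_derivative (\<lambda>x. 0) (\<lambda>x. 0)"
    by (auto simp: L2_def has_weak_derivative_def locally_integrable_def set_integrable_def)
  show "(\<lambda>x. 0) \<in> H1" "H1_norm (\<lambda>x. 0) = 0"
    using H1I(1)[OF z z(2)] H1_norm_eq[OF z z(2)] by auto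
qed

lemma L2_norm_weak_deriv_diff:
  assumes "f \<in> H1" "g \<in> H1"
  shows "L2_norm (\<lambda>x. weak_deriv f x - weak_deriv g x) = L2_norm (weak_deriv (\<lambda>x. f x - g x))"
proof -
  note f = H1D[OF assms(1)] and g = H1D[OF H1_cmult(1)[OF assms(2), of "-1"]] and g' = H1D[OF assms(2)]
  have w: "has_weak_derivative (\<lambda>x. f x + (-1) * g x) (\<lambda>x. weak_deriv f x + (-1) * weak_deriv g x)"
    by (intro has_weak_derivative_add has_weak_derivative_cmult f g')
  have c: "continuous_on UNIV (\<lambda>x. f x + (-1) * g x)"
    using f(1) g(1) by (intro continuous_on_add)
  have "L2_norm (weak_deriv (\<lambda>x. f x + (-1) * g x)) = L2_norm (\<lambda>x. weak_deriv f x + (-1) * weak_deriv g x)"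
    by (rule H1I(2)[OF c _ w]) (intro L2_add L2_cmult f g')+
  then show ?thesis by simp
qed

section \<open>The Sobolev embedding\<close>

text \<open>The product rule $(f^2)' = 2 f d$ in integrated form, for a merely integrable \<open>d\<close>. By Fubini
  the square $(f(b) - f(a))^2 = \int \int d(s) d(t)$ is twice the integral over the triangle
  $s \le t$, whose inner integral is $f(t) - f(a)$.\<close>

lemma weak_derivative_square_FTC:
  assumes f: "continuous_on UNIV f" and wd: "has_weak_derivative f d" and ab: "a \<le> b"
  shows "(f b)\<^sup>2 - (f a)\<^sup>2 = 2 * (LINT x|lebesgue. indicator {a..b} x * (f x * d x))"
proof -
  have ld: "locally_integrable d" using wd by (auto simp: has_weak_derivative_def)
  have id: "integrable lebesgue (\<lambda>x. indicator {u..v} x * d x)" for u v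
    using ld unfolding locally_integrable_def set_integrable_def by simp
  \<comment> \<open>Fubini's theorem needs Borel measurability on the product, so \<open>d\<close> is replaced by a Borel
    function that vanishes outside the interval.\<close>
  obtain e0 where e0: "e0 \<in> borel_measurable lborel" "AE x in lborel. d x = e0 x"
    using completion_ex_borel_measurable_real[OF locally_integrable_measurable[OF ld]] by blast
  have ae: "AE x in lebesgue. d x = e0 x" using e0(2) by (rule AE_completion)
  define e where "e x = indicator {a..b} x * e0 x" for x
  have [measurable]: "e \<in> borel_measurable borel"
    using e0(1) by (simp add: e_def[abs_def])
  have "integrable lebesgue e"
    by (rule integrable_cong_AE_imp[OF id[of a b]])
       (use ae in \<open>auto simp: e_def measurable_completion elim: eventually_mono\<close>)
  then have ie: "integrable lborel e" by (simp add: integrable_completion)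
  have E: "(LINT s|lborel. indicator {..t} s * e s) = f t - f a" if "t \<in> {a..b}" for t
  proof -
    have "(LINT s|lborel. indicator {..t} s * e s) = (LINT s|lebesgue. indicator {..t} s * e s)"
      by (intro integral_completion[symmetric]) simp
    also have "\<dots> = (LINT s|lebesgue. indicator {a..t} s * d s)"
    proof (rule integral_cong_AE)
      have "(\<lambda>s. indicator {..t} s * e s) \<in> borel_measurable lborel" by simp
      then show "(\<lambda>s. indicator {..t} s * e s) \<in> borel_measurable lebesgue" by (rule measurable_completion)
      show "(\<lambda>s. indicator {a..t} s * d s) \<in> borel_measurable lebesgue"
        by (rule borel_measurable_integrable[OF id])
      show "AE s in lebesgue. indicator {..t} s * e s = indicator {a..t} s * d s"
        using ae by eventually_elim (use that in \<open>auto simp: e_def indicator_def\<close>)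
    qed
    also have "\<dots> = f t - f a"
      using that by (intro weak_derivative_FTC[OF f wd]) auto
    finally show ?thesis .
  qed
  have tot: "(LINT s|lborel. e s) = f b - f a"
  proof -
    have "e s = indicator {..b} s * e s" for s by (auto simp: e_def indicator_def)
    then show ?thesis using E[of b] ab by (metis (no_types, lifting) Bochner_Integration.integral_cong atLeastAtMost_iff order_refl)
  qed
  define k where "k s t = indicator {..t} s * (e s * e t)" for s t
  have ik: "integrable (lborel \<Otimes>\<^sub>M lborel) (case_prod k)"
  proof (rule Bochner_Integration.integrable_bound)
    show "integrable (lborel \<Otimes>\<^sub>M lborel) (\<lambda>(s, t). e s * e t)"
    proof (rule lborel_pair.Fubini_integrable)
      show "AE s in lborel. integrable lborel (\<lambda>t. case (s, t) of (s, t) \<Rightarrow> e s * e t)"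
        using ie by simp
      show "integrable lborel (\<lambda>s. LINT t|lborel. norm (case (s, t) of (s, t) \<Rightarrow> e s * e t))"
        using ie by (simp add: abs_mult)
    qed measurable
    show "case_prod k \<in> borel_measurable (lborel \<Otimes>\<^sub>M lborel)"
    proof -
      have "case_prod k = (\<lambda>p. if fst p \<le> snd p then e (fst p) * e (snd p) else 0)"
        by (auto simp: k_def fun_eq_iff)
      moreover have "(\<lambda>p. if fst p \<le> snd p then e (fst p) * e (snd p) else 0) \<in> borel_measurable (borel \<Otimes>\<^sub>M borel)"
        by measurable
      ultimately show ?thesis by (simp add: lborel_prod[symmetric] cong: measurable_cong_sets)
    qed
    show "AE x in lborel \<Otimes>\<^sub>M lborel. norm (case_prod k x) \<le> norm (case x of (s, t) \<Rightarrow> e s * e t)"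
      by (auto simp: k_def indicator_def)
  qed
  define A where "A = (LINT t|lborel. LINT s|lborel. k s t)"
  have i1: "integrable lborel (\<lambda>t. LINT s|lborel. k s t)" and i2: "integrable lborel (\<lambda>t. LINT s|lborel. k t s)"
    using lborel_pair.integrable_snd[OF ik] lborel_pair.integrable_fst[OF ik] by auto
  have ind: "integrable lborel (\<lambda>s. indicator A s * e s)" if "A \<in> sets borel" for A
    by (rule Bochner_Integration.integrable_bound[OF ie]) (use that in \<open>auto simp: indicator_def\<close>)
  have "(\<integral>s. e s \<partial>lborel)\<^sup>2 = (LINT t|lborel. (LINT s|lborel. k s t) + (LINT s|lborel. k t s))"
  proof -
    have "(LINT s|lborel. k s t) + (LINT s|lborel. k t s) = e t * (LINT s|lborel. e s)" for t
    proof -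
      have "(LINT s|lborel. k s t) + (LINT s|lborel. k t s)
        = (LINT s|lborel. e t * (indicator {..t} s * e s)) + (LINT s|lborel. e t * (indicator {t..} s * e s))"
        by (simp add: k_def mult_ac indicator_def)
      also have "\<dots> = (LINT s|lborel. e t * (indicator {..t} s * e s) + e t * (indicator {t..} s * e s))"
        by (intro Bochner_Integration.integral_add[symmetric] integrable_mult_right ind) auto
      also have "\<dots> = (LINT s|lborel. e t * e s)"
      proof (rule integral_cong_AE)
        show "AE s in lborel. e t * (indicator {..t} s * e s) + e t * (indicator {t..} s * e s) = e t * e s"
          using AE_lborel_singleton[of t] by eventually_elim (auto simp: indicator_def)
      qed measurable
      finally show ?thesis by simp
    qed
    then show ?thesis by (simp add: power2_eq_square)
  qed
  also have "\<dots> = A + (LINT t|lborel. LINT s|lborel. k t s)"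
    unfolding A_def using i1 i2 by (rule Bochner_Integration.integral_add)
  also have "(LINT t|lborel. LINT s|lborel. k t s) = A"
    unfolding A_def by (rule lborel_pair.Fubini_integral[OF ik, symmetric])
  also have "A = (LINT t|lborel. e t * f t - f a * e t)"
    unfolding A_def
  proof (intro Bochner_Integration.integral_cong refl)
    fix t
    have "(LINT s|lborel. k s t) = (LINT s|lborel. e t * (indicator {..t} s * e s))"
      by (simp add: k_def mult_ac)
    also have "\<dots> = e t * (LINT s|lborel. indicator {..t} s * e s)" by simp
    also have "\<dots> = e t * f t - f a * e t"
    proof (cases "t \<in> {a..b}")
      case True
      show ?thesis unfolding E[OF True] by (simp add: algebra_simps)
    qed (simp add: e_def)
    finally show "(LINT s|lborel. k s t) = e t * f t - f a * e t" .
  qed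
  also have "\<dots> = (LINT t|lborel. e t * f t) - f a * (LINT t|lborel. e t)"
  proof -
    obtain B where B: "\<And>x. x \<in> {a..b} \<Longrightarrow> \<bar>f x\<bar> \<le> B"
      using continuous_on_Icc_bounded[OF continuous_on_subset[OF f subset_UNIV]] by blast
    have "integrable lborel (\<lambda>t. e t * f t)"
    proof (rule Bochner_Integration.integrable_bound[OF integrable_mult_right[OF ie, of B]])
      have "f \<in> borel_measurable borel" by (rule borel_measurable_continuous_onI[OF f])
      then show "(\<lambda>t. e t * f t) \<in> borel_measurable lborel" by simp
      have "\<bar>e t\<bar> * \<bar>f t\<bar> \<le> \<bar>e t\<bar> * \<bar>B\<bar>" for t
        using B[of t] by (cases "t \<in> {a..b}") (auto simp: e_def intro!: mult_left_mono)
      then show "AE t in lborel. norm (e t * f t) \<le> norm (B * e t)"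
        by (simp add: abs_mult mult.commute)
    qed
    then show ?thesis using ie by simp
  qed
  also have "(LINT t|lborel. e t * f t) = (LINT x|lebesgue. indicator {a..b} x * (f x * d x))"
  proof -
    have fm: "f \<in> borel_measurable borel" by (rule borel_measurable_continuous_onI[OF f])
    then have m: "(\<lambda>t. e t * f t) \<in> borel_measurable lborel" by simp
    then have "(LINT t|lborel. e t * f t) = (LINT t|lebesgue. e t * f t)"
      by (rule integral_completion[symmetric])
    also have "\<dots> = (LINT x|lebesgue. f x * (indicator {a..b} x * d x))"
    proof (rule integral_cong_AE)
      show "(\<lambda>t. e t * f t) \<in> borel_measurable lebesgue" using m by (rule measurable_completion)
      show "(\<lambda>x. f x * (indicator {a..b} x * d x)) \<in> borel_measurable lebesgue"
        by (intro borel_measurable_times borel_measurable_integrable[OF id] continuous_measurable_lebesgue f)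
      show "AE x in lebesgue. e x * f x = f x * (indicator {a..b} x * d x)"
        using ae by eventually_elim (auto simp: e_def)
    qed
    finally show ?thesis by (simp add: mult_ac)
  qed
  finally have "(f b - f a)\<^sup>2 = 2 * ((LINT x|lebesgue. indicator {a..b} x * (f x * d x)) - f a * (f b - f a))"
    unfolding tot by simp
  then show ?thesis by (simp add: power2_eq_square algebra_simps)
qed

text \<open>Otherwise the square would exceed \<open>\<epsilon>\<close> on intervals longer than $\|f\|^2 / \epsilon$.\<close>

lemma L2_small_on_halflines:
  assumes "f \<in> L2" "\<epsilon> > 0"
  shows "\<exists>a\<le>x. (f a)\<^sup>2 < \<epsilon>" and "\<exists>b\<ge>x. (f b)\<^sup>2 < \<epsilon>"
proof -
  have *: "\<exists>y\<in>{u..v}. (f y)\<^sup>2 < \<epsilon>" if "v - u > (L2_norm f)\<^sup>2 / \<epsilon>" "u \<le> v" for u v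
  proof (rule ccontr)
    assume "\<not> ?thesis"
    then have ge: "\<epsilon> * indicator {u..v} y \<le> (f y)\<^sup>2" for y
      by (auto simp: indicator_def not_less)
    have "\<epsilon> * (v - u) = (LINT y|lebesgue. \<epsilon> * indicator {u..v} y)"
      using that(2) by simp
    also have "\<dots> \<le> (L2_norm f)\<^sup>2"
      unfolding L2_norm_power2
      by (intro integral_mono L2D(2)[OF assms(1)] ge)
         (auto intro!: integrable_mult_right integrable_real_indicator simp: emeasure_lborel_Icc_eq)
    finally show False using that(1) assms(2) by (simp add: field_simps)
  qed
  have c: "(L2_norm f)\<^sup>2 / \<epsilon> \<ge> 0" using assms(2) by simp
  have "\<exists>y\<in>{x - (L2_norm f)\<^sup>2 / \<epsilon> - 1..x}. (f y)\<^sup>2 < \<epsilon>"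
    by (rule *) (use c in auto)
  then show "\<exists>a\<le>x. (f a)\<^sup>2 < \<epsilon>" by auto
  have "\<exists>y\<in>{x..x + (L2_norm f)\<^sup>2 / \<epsilon> + 1}. (f y)\<^sup>2 < \<epsilon>"
    by (rule *) (use c in auto)
  then show "\<exists>b\<ge>x. (f b)\<^sup>2 < \<epsilon>" by auto
qed

text \<open>From $|f(v)^2 - f(u)^2| \le \int_u^v 2 |f d| \le \int_u^v (f^2 + d^2)$ on both sides of \<open>x\<close>,
  with outer end points at which \<open>f\<close> is small. Using both sides produces the factor $1/2$, which
  matches the radius of the ball on which the nonlinearity is controlled.\<close>

lemma H1_sup_bound:
  assumes "f \<in> H1"
  shows "(f x)\<^sup>2 \<le> (H1_norm f)\<^sup>2 / 2"
proof -
  define d where "d = weak_deriv f"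
  note f = H1D[OF assms, folded d_def]
  define h where "h y = (f y)\<^sup>2 + (d y)\<^sup>2" for y
  have ih: "integrable lebesgue h"
    unfolding h_def[abs_def] by (intro Bochner_Integration.integrable_add L2D f)
  have hnn: "h y \<ge> 0" for y by (simp add: h_def)
  have norm: "(H1_norm f)\<^sup>2 = (LINT y|lebesgue. h y)"
    unfolding h_def H1_norm_def using L2D(2)[OF f(2)] L2D(2)[OF f(4)]
    by (simp add: L2_norm_power2 d_def)
  have ihi: "integrable lebesgue (\<lambda>y. indicator A y * h y)" if "A \<in> sets lebesgue" for A
    by (rule Bochner_Integration.integrable_bound[OF ih])
       (use that ih in \<open>auto simp: indicator_def intro!: AE_I2 borel_measurable_times\<close>)
  have diff: "\<bar>(f v)\<^sup>2 - (f u)\<^sup>2\<bar> \<le> (LINT y|lebesgue. indicator {u..v} y * h y)" if "u \<le> v" for u v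
  proof -
    have i: "integrable lebesgue (\<lambda>y. indicator {u..v} y * (f y * d y))"
    proof (rule Bochner_Integration.integrable_bound[OF L2_mult_integrable[OF f(2,4)]])
      show "(\<lambda>y. indicator {u..v} y * (f y * d y)) \<in> borel_measurable lebesgue"
        by (intro borel_measurable_times borel_measurable_indicator L2D(1) f) simp
    qed (auto simp: indicator_def)
    have "\<bar>(f v)\<^sup>2 - (f u)\<^sup>2\<bar> = 2 * \<bar>LINT y|lebesgue. indicator {u..v} y * (f y * d y)\<bar>"
      using weak_derivative_square_FTC[OF f(1,3) that] by simp
    also have "\<dots> \<le> 2 * (LINT y|lebesgue. \<bar>indicator {u..v} y * (f y * d y)\<bar>)"
      by simp
    also have "\<dots> = (LINT y|lebesgue. 2 * \<bar>indicator {u..v} y * (f y * d y)\<bar>)"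
      by simp
    also have "\<dots> \<le> (LINT y|lebesgue. indicator {u..v} y * h y)"
    proof (rule integral_mono)
      show "integrable lebesgue (\<lambda>y. 2 * \<bar>indicator {u..v} y * (f y * d y)\<bar>)"
        using i by (intro integrable_mult_right integrable_abs)
      show "integrable lebesgue (\<lambda>y. indicator {u..v} y * h y)"
        by (rule ihi) simp
      fix y
      show "2 * \<bar>indicator {u..v} y * (f y * d y)\<bar> \<le> indicator {u..v} y * h y"
        using sum_squares_bound[of "\<bar>f y\<bar>" "\<bar>d y\<bar>"]
        by (simp add: h_def indicator_def abs_mult)
    qed
    finally show ?thesis .
  qed
  have "2 * (f x)\<^sup>2 \<le> (H1_norm f)\<^sup>2 + \<epsilon>" if "\<epsilon> > 0" for \<epsilon>
  proof -
    obtain a where a: "a \<le> x" "(f a)\<^sup>2 < \<epsilon> / 2"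
      using L2_small_on_halflines(1)[OF f(2), of "\<epsilon> / 2" x] \<open>\<epsilon> > 0\<close> by auto
    obtain b where b: "x \<le> b" "(f b)\<^sup>2 < \<epsilon> / 2"
      using L2_small_on_halflines(2)[OF f(2), of "\<epsilon> / 2" x] \<open>\<epsilon> > 0\<close> by auto
    have "2 * (f x)\<^sup>2 \<le> (LINT y|lebesgue. indicator {a..x} y * h y) + (LINT y|lebesgue. indicator {x..b} y * h y) + \<epsilon>"
      using diff[OF a(1)] diff[OF b(1)] a(2) b(2) by linarith
    also have "(LINT y|lebesgue. indicator {a..x} y * h y) + (LINT y|lebesgue. indicator {x..b} y * h y)
      = (LINT y|lebesgue. indicator {a..x} y * h y + indicator {x..b} y * h y)"
      by (intro Bochner_Integration.integral_add[symmetric] ihi) simp_all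
    also have "\<dots> \<le> (LINT y|lebesgue. h y)"
    proof (rule integral_mono_AE[OF _ ih])
      show "integrable lebesgue (\<lambda>y. indicator {a..x} y * h y + indicator {x..b} y * h y)"
        by (intro Bochner_Integration.integrable_add ihi) simp_all
      have "AE y in lebesgue. y \<noteq> x"
        by (intro AE_completion AE_lborel_singleton)
      then show "AE y in lebesgue. indicator {a..x} y * h y + indicator {x..b} y * h y \<le> h y"
        by eventually_elim (auto simp: indicator_def hnn)
    qed
    finally show ?thesis by (simp add: norm)
  qed
  then have "2 * (f x)\<^sup>2 \<le> (H1_norm f)\<^sup>2"
    by (rule field_le_epsilon)
  then show ?thesis by simp
qed

lemma H1_abs_le_norm:
  assumes "f \<in> H1"
  shows "\<bar>f x\<bar> \<le> H1_norm f"
proof (rule power2_le_imp_le)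
  show "\<bar>f x\<bar>\<^sup>2 \<le> (H1_norm f)\<^sup>2"
    using H1_sup_bound[OF assms, of x] zero_le_power2[of "H1_norm f"] unfolding power2_abs by linarith
qed simp

section \<open>Completeness\<close>

lemma test_function_L2:
  assumes "test_function \<phi>"
  shows "\<phi> \<in> L2" "deriv \<phi> \<in> L2"
proof -
  have c: "continuous_on UNIV \<phi>" "continuous_on UNIV (deriv \<phi>)"
    using test_function_smooth[OF assms] by (auto intro: smooth_continuous_on smooth_deriv)
  then show "\<phi> \<in> L2" "deriv \<phi> \<in> L2"
    using test_function_integrable[OF assms continuous_locally_integrable] continuous_measurable_lebesgue
    by (auto simp: L2_def power2_eq_square)
qed

text \<open>The defining identity of the weak derivative is continuous in the $L^2$ norm, because test
  functions and their derivatives are square integrable.\<close>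

lemma has_weak_derivative_L2_limit:
  assumes f: "\<And>n. f n \<in> L2" and g: "g \<in> L2" and d: "\<And>n. d n \<in> L2" and e: "e \<in> L2"
    and wd: "\<And>n. has_weak_derivative (f n) (d n)"
    and fg: "(\<lambda>n. L2_norm (\<lambda>x. f n x - g x)) \<longlonglongrightarrow> 0"
    and de: "(\<lambda>n. L2_norm (\<lambda>x. d n x - e x)) \<longlonglongrightarrow> 0"
  shows "has_weak_derivative g e"
proof -
  have lim: "(\<lambda>n. LINT x|lebesgue. F n x * \<psi> x) \<longlonglongrightarrow> (LINT x|lebesgue. G x * \<psi> x)"
    if F: "\<And>n. F n \<in> L2" and G: "G \<in> L2" and \<psi>: "\<psi> \<in> L2"
      and FG: "(\<lambda>n. L2_norm (\<lambda>x. F n x - G x)) \<longlonglongrightarrow> 0" for F :: "nat \<Rightarrow> real \<Rightarrow> real" and G \<psi>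
  proof (rule LIM_zero_cancel, rule Lim_null_comparison)
    show "\<forall>\<^sub>F n in sequentially. norm ((LINT x|lebesgue. F n x * \<psi> x) - (LINT x|lebesgue. G x * \<psi> x))
        \<le> L2_norm (\<lambda>x. F n x - G x) * L2_norm \<psi>"
    proof (rule always_eventually, rule allI)
      fix n
      have "(LINT x|lebesgue. F n x * \<psi> x) - (LINT x|lebesgue. G x * \<psi> x)
        = (LINT x|lebesgue. (F n x - G x) * \<psi> x)"
        using L2_mult_integrable[OF F \<psi>] L2_mult_integrable[OF G \<psi>] by (simp add: left_diff_distrib)
      then show "norm ((LINT x|lebesgue. F n x * \<psi> x) - (LINT x|lebesgue. G x * \<psi> x))
        \<le> L2_norm (\<lambda>x. F n x - G x) * L2_norm \<psi>"
        using L2_Cauchy_Schwarz[OF L2_diff[OF F G] \<psi>] by simp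
    qed
    show "(\<lambda>n. L2_norm (\<lambda>x. F n x - G x) * L2_norm \<psi>) \<longlonglongrightarrow> 0"
      using tendsto_mult_right[OF FG, of "L2_norm \<psi>"] by simp
  qed
  have "(LINT x|lebesgue. g x * deriv \<phi> x) = - (LINT x|lebesgue. e x * \<phi> x)" if t: "test_function \<phi>" for \<phi>
  proof (rule LIMSEQ_unique)
    show "(\<lambda>n. LINT x|lebesgue. f n x * deriv \<phi> x) \<longlonglongrightarrow> (LINT x|lebesgue. g x * deriv \<phi> x)"
      by (rule lim[OF f g test_function_L2(2)[OF t] fg])
    have "(LINT x|lebesgue. f n x * deriv \<phi> x) = - (LINT x|lebesgue. d n x * \<phi> x)" for n
      using wd t by (auto simp: has_weak_derivative_def)
    then show "(\<lambda>n. LINT x|lebesgue. f n x * deriv \<phi> x) \<longlonglongrightarrow> - (LINT x|lebesgue. e x * \<phi> x)"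
      using tendsto_minus[OF lim[OF d e test_function_L2(1)[OF t] de]] by simp
  qed
  then show ?thesis
    using L2_locally_integrable[OF g] L2_locally_integrable[OF e] by (simp add: has_weak_derivative_def)
qed

text \<open>The sequence converges uniformly by the Sobolev embedding, which provides the continuous
  representative; its $L^2$ limit is the same function almost everywhere.\<close>

lemma H1_complete_geometric:
  assumes F: "\<And>n. F n \<in> H1" and q: "0 < q" "q < 1" and C: "0 \<le> C"
    and step: "\<And>n. H1_norm (\<lambda>x. F (Suc n) x - F n x) \<le> C * q ^ n"
  shows "\<exists>f\<in>H1. (\<lambda>n. H1_norm (\<lambda>x. F n x - f x)) \<longlonglongrightarrow> 0"
proof -
  have Fd: "(\<lambda>x. F m x - F n x) \<in> H1" for m n by (intro H1_diff F)
  have "uniform_limit UNIV (\<lambda>n x. \<Sum>i<n. F (Suc i) x - F i x) (\<lambda>x. \<Sum>i. F (Suc i) x - F i x) sequentially"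
  proof (rule Weierstrass_m_test)
    show "norm (F (Suc n) x - F n x) \<le> C * q ^ n" for n x
      using order_trans[OF H1_abs_le_norm[OF Fd] step[of n], of x] by simp
    show "summable (\<lambda>n. C * q ^ n)"
      using q by (intro summable_mult summable_geometric) auto
  qed
  moreover have "(\<Sum>i<n. F (Suc i) x - F i x) = F n x - F 0 x" for n x
    by (rule sum_lessThan_telescope)
  ultimately have "uniform_limit UNIV (\<lambda>n x. (F n x - F 0 x) + F 0 x) (\<lambda>x. (\<Sum>i. F (Suc i) x - F i x) + F 0 x) sequentially"
    by (intro uniform_limit_add uniform_limit_const) simp
  then obtain f where u: "uniform_limit UNIV F f sequentially" by auto
  have cf: "continuous_on UNIV f"
    by (rule uniform_limit_theorem[OF _ u]) (simp_all add: H1D(1)[OF F])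
  have pt: "(\<lambda>n. F n x) \<longlonglongrightarrow> f x" for x
    by (rule tendsto_uniform_limitI[OF u]) simp
  have s1: "L2_norm (\<lambda>x. F (Suc n) x - F n x) \<le> C * q ^ n" for n
    using H1_norm_ge_L2_norm(1) step[of n] by (rule order_trans)
  have s2: "L2_norm (\<lambda>x. weak_deriv (F (Suc n)) x - weak_deriv (F n) x) \<le> C * q ^ n" for n
    unfolding L2_norm_weak_deriv_diff[OF F F]
    using H1_norm_ge_L2_norm(2) step[of n] by (rule order_trans)
  obtain g where g: "g \<in> L2" "(\<lambda>n. L2_norm (\<lambda>x. F n x - g x)) \<longlonglongrightarrow> 0"
    "AE x in lebesgue. (\<lambda>n. F n x) \<longlonglongrightarrow> g x"
    by (rule L2_complete_geometric[OF H1D(2)[OF F] q C s1]) (rule that)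
  obtain e where e: "e \<in> L2" "(\<lambda>n. L2_norm (\<lambda>x. weak_deriv (F n) x - e x)) \<longlonglongrightarrow> 0"
    "AE x in lebesgue. (\<lambda>n. weak_deriv (F n) x) \<longlonglongrightarrow> e x"
    by (rule L2_complete_geometric[OF H1D(4)[OF F] q C s2]) (rule that)
  have ae: "AE x in lebesgue. g x = f x"
    using g(3) by eventually_elim (rule LIMSEQ_unique[OF _ pt])
  have fL2: "f \<in> L2"
    by (rule L2_cong_AE(1)[OF g(1) continuous_measurable_lebesgue[OF cf] ae])
  have "L2_norm (\<lambda>x. F n x - f x) = L2_norm (\<lambda>x. F n x - g x)" for n
  proof (rule L2_cong_AE(2))
    show "(\<lambda>x. F n x - g x) \<in> L2" by (intro L2_diff H1D(2)[OF F] g)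
    show "(\<lambda>x. F n x - f x) \<in> borel_measurable lebesgue"
      by (intro L2D(1) L2_diff H1D(2)[OF F] fL2)
    show "AE x in lebesgue. F n x - g x = F n x - f x"
      using ae by eventually_elim simp
  qed
  then have fl: "(\<lambda>n. L2_norm (\<lambda>x. F n x - f x)) \<longlonglongrightarrow> 0"
    using g(2) by simp
  have w: "has_weak_derivative f e"
    by (rule has_weak_derivative_L2_limit[OF H1D(2)[OF F] fL2 H1D(4)[OF F] e(1) H1D(3)[OF F] fl e(2)])
  note f = H1I(1)[OF cf fL2 w e(1)]
  have "L2_norm (\<lambda>x. weak_deriv f x - e x) = L2_norm (\<lambda>x. 0)"
  proof (rule L2_cong_AE(2))
    show "(\<lambda>x. 0) \<in> L2" using H1_zero(1) by (auto dest: H1D)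
    show "(\<lambda>x. weak_deriv f x - e x) \<in> borel_measurable lebesgue"
      by (intro L2D(1) L2_diff H1D(4)[OF f] e)
    show "AE x in lebesgue. 0 = weak_deriv f x - e x"
      using weak_derivative_unique[OF cf H1D(3)[OF f] w] by eventually_elim simp
  qed
  have dl: "L2_norm (weak_deriv (\<lambda>x. F n x - f x)) = L2_norm (\<lambda>x. weak_deriv (F n) x - e x)" for n
    unfolding L2_norm_weak_deriv_diff[OF F f, symmetric]
  proof (rule L2_cong_AE(2))
    show "(\<lambda>x. weak_deriv (F n) x - e x) \<in> L2" by (intro L2_diff H1D(4)[OF F] e)
    show "(\<lambda>x. weak_deriv (F n) x - weak_deriv f x) \<in> borel_measurable lebesgue"
      by (intro L2D(1) L2_diff H1D(4)[OF F] H1D(4)[OF f])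
    show "AE x in lebesgue. weak_deriv (F n) x - e x = weak_deriv (F n) x - weak_deriv f x"
      using weak_derivative_unique[OF cf H1D(3)[OF f] w] by eventually_elim simp
  qed
  have "(\<lambda>n. sqrt ((L2_norm (\<lambda>x. F n x - f x))\<^sup>2 + (L2_norm (weak_deriv (\<lambda>x. F n x - f x)))\<^sup>2)) \<longlonglongrightarrow> sqrt (0\<^sup>2 + 0\<^sup>2)"
    unfolding dl by (intro tendsto_intros fl e(2))
  then show ?thesis
    using f by (auto simp: H1_norm_def)
qed

section \<open>Convolution with an integrable kernel\<close>

lemma convolution_commute:
  fixes K G :: "real \<Rightarrow> real"
  shows "(LINT y|lebesgue. K (x - y) * G y) = (LINT z|lebesgue. K z * G (x - z))"
  by (subst lebesgue_integral_real_affine[where c = "-1" and t = x]) simp_all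

text \<open>For a kernel that is only Lebesgue measurable, \<open>K (x - y)\<close> need not be measurable for the
  product sigma algebra. Changing the kernel on a null set does not change its convolutions, so all
  double integrals are computed with a Borel representative.\<close>

lemma convolution_borel_representative:
  assumes "integrable lebesgue K"
  obtains k where "k \<in> borel_measurable borel" "integrable lborel k"
    "(LINT z|lborel. \<bar>k z\<bar>) = L1_norm K"
    "\<And>G x. G \<in> borel_measurable borel \<Longrightarrow>
      (LINT y|lebesgue. K (x - y) * G y) = (LINT y|lborel. k (x - y) * G y)"
proof -
  obtain k where k: "k \<in> borel_measurable lborel" "AE x in lborel. K x = k x"
    using completion_ex_borel_measurable_real[OF borel_measurable_integrable[OF assms]] by blast
  have kb: "k \<in> borel_measurable borel" using k(1) by simp
  have ae: "AE x in lebesgue. K x = k x" using k(2) by (rule AE_completion)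
  have kl: "k \<in> borel_measurable lebesgue" using k(1) by (rule measurable_completion)
  have "integrable lebesgue k"
    using integrable_cong_AE[OF borel_measurable_integrable[OF assms] kl ae] assms by simp
  then have ik: "integrable lborel k" using k(1) by (simp add: integrable_completion)
  have L1: "(LINT z|lborel. \<bar>k z\<bar>) = L1_norm K"
  proof -
    have "(LINT z|lborel. \<bar>k z\<bar>) = (LINT z|lebesgue. \<bar>k z\<bar>)"
      using k(1) by (intro integral_completion[symmetric]) simp
    also have "\<dots> = L1_norm K"
      unfolding L1_norm_def
    proof (rule integral_cong_AE)
      show "(\<lambda>z. \<bar>k z\<bar>) \<in> borel_measurable lebesgue" "(\<lambda>z. \<bar>K z\<bar>) \<in> borel_measurable lebesgue"
        using kl borel_measurable_integrable[OF assms] by measurable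
      show "AE z in lebesgue. \<bar>k z\<bar> = \<bar>K z\<bar>" using ae by eventually_elim simp
    qed
    finally show ?thesis .
  qed
  have "(LINT y|lebesgue. K (x - y) * G y) = (LINT y|lborel. k (x - y) * G y)"
    if G: "G \<in> borel_measurable borel" for G x
  proof -
    have m: "(\<lambda>z. G (x - z)) \<in> borel_measurable lborel" using G by measurable
    have "(LINT y|lebesgue. K (x - y) * G y) = (LINT z|lebesgue. K z * G (x - z))"
      by (rule convolution_commute)
    also have "\<dots> = (LINT z|lebesgue. k z * G (x - z))"
    proof (rule integral_cong_AE)
      show "(\<lambda>z. K z * G (x - z)) \<in> borel_measurable lebesgue" "(\<lambda>z. k z * G (x - z)) \<in> borel_measurable lebesgue"
        by (intro borel_measurable_times kl borel_measurable_integrable[OF assms] measurable_completion[OF m])+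
      show "AE z in lebesgue. K z * G (x - z) = k z * G (x - z)"
        using ae by eventually_elim simp
    qed
    also have "\<dots> = (LINT y|lebesgue. k (x - y) * G y)"
      by (rule convolution_commute[symmetric])
    also have "\<dots> = (LINT y|lborel. k (x - y) * G y)"
    proof (rule integral_completion)
      note [measurable] = G kb
      show "(\<lambda>y. k (x - y) * G y) \<in> borel_measurable lborel" by measurable
    qed
    finally show ?thesis .
  qed
  then show ?thesis by (rule that[OF kb ik L1])
qed

lemma convolution_integrable:
  fixes k G :: "real \<Rightarrow> real"
  assumes k: "integrable lborel k" and G: "G \<in> borel_measurable borel" "\<And>x. \<bar>G x\<bar> \<le> B"
  shows "integrable lborel (\<lambda>y. k (x - y) * G y)" "(LINT y|lborel. \<bar>k (x - y) * G y\<bar>) \<le> B * (LINT z|lborel. \<bar>k z\<bar>)"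
proof -
  have [measurable]: "k \<in> borel_measurable borel"
    using k by (simp add: borel_measurable_integrable flip: measurable_lborel1)
  have ik: "integrable lborel (\<lambda>y. k (x - y))"
    using lborel_integrable_real_affine[OF k, of "-1" x] by simp
  have B: "0 \<le> B" using G(2)[of 0] by linarith
  have le: "\<bar>k (x - y) * G y\<bar> \<le> B * \<bar>k (x - y)\<bar>" for y
    using mult_left_mono[OF G(2)[of y], of "\<bar>k (x - y)\<bar>"] by (simp add: abs_mult mult.commute)
  show i: "integrable lborel (\<lambda>y. k (x - y) * G y)"
    by (rule Bochner_Integration.integrable_bound[OF integrable_mult_right[OF ik, of B]])
       (use le B G(1) in \<open>auto simp: abs_mult\<close>)
  have "(LINT y|lborel. \<bar>k (x - y) * G y\<bar>) \<le> (LINT y|lborel. B * \<bar>k (x - y)\<bar>)"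
    by (rule integral_mono) (use i ik le in \<open>auto intro: integrable_abs integrable_mult_right\<close>)
  also have "\<dots> = B * (LINT y|lborel. \<bar>k (x - y)\<bar>)" by simp
  also have "(LINT y|lborel. \<bar>k (x - y)\<bar>) = (LINT z|lborel. \<bar>k z\<bar>)"
    using lborel_integral_real_affine[of "-1" "\<lambda>z. \<bar>k z\<bar>" x] by simp
  finally show "(LINT y|lborel. \<bar>k (x - y) * G y\<bar>) \<le> B * (LINT z|lborel. \<bar>k z\<bar>)" .
qed

text \<open>By Cauchy-Schwarz with the weight $|K(x - y)|$,
  $|(K * G)(x)|^2 \le \|K\|_{L^1} \int |K(x - y)| \, |G(y)|^2 dy$; integrating in \<open>x\<close> and exchanging
  the integrals gives another factor $\|K\|_{L^1}$. Boundedness of \<open>G\<close> makes the convolution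
  integral converge for every \<open>x\<close>.\<close>

lemma Young_L1_L2:
  assumes K: "integrable lebesgue K" and G: "G \<in> borel_measurable borel" "\<And>x. \<bar>G x\<bar> \<le> B" "G \<in> L2"
  shows "(\<lambda>x. LINT y|lebesgue. K (x - y) * G y) \<in> L2"
    and "L2_norm (\<lambda>x. LINT y|lebesgue. K (x - y) * G y) \<le> L1_norm K * L2_norm G"
proof -
  obtain k where [measurable]: "k \<in> borel_measurable borel" and ik: "integrable lborel k"
    and L1: "(LINT z|lborel. \<bar>k z\<bar>) = L1_norm K"
    and eq: "\<And>G x. G \<in> borel_measurable borel \<Longrightarrow>
      (LINT y|lebesgue. K (x - y) * G y) = (LINT y|lborel. k (x - y) * G y)"
    by (rule convolution_borel_representative[OF K]) (rule that)
  have [measurable]: "G \<in> borel_measurable borel" by fact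
  have k1: "(\<integral>\<^sup>+y. ennreal \<bar>k (x - y)\<bar> \<partial>lborel) = ennreal (L1_norm K)" for x
  proof -
    have "(\<integral>\<^sup>+y. ennreal \<bar>k (x - y)\<bar> \<partial>lborel) = (\<integral>\<^sup>+z. ennreal \<bar>k z\<bar> \<partial>lborel)"
      by (subst nn_integral_real_affine[where c = "-1" and t = x]) auto
    also have "\<dots> = ennreal (L1_norm K)"
      unfolding L1[symmetric] using ik by (intro nn_integral_eq_integral) auto
    finally show ?thesis .
  qed
  have k2: "(\<integral>\<^sup>+x. ennreal \<bar>k (x - y)\<bar> \<partial>lborel) = ennreal (L1_norm K)" for y
  proof -
    have "(\<integral>\<^sup>+x. ennreal \<bar>k (x - y)\<bar> \<partial>lborel) = (\<integral>\<^sup>+z. ennreal \<bar>k z\<bar> \<partial>lborel)"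
      by (subst nn_integral_real_affine[where c = "1" and t = "y"]) auto
    also have "\<dots> = ennreal (L1_norm K)"
      unfolding L1[symmetric] using ik by (intro nn_integral_eq_integral) auto
    finally show ?thesis .
  qed
  define c where "c x = (LINT y|lborel. k (x - y) * G y)" for x
  have [measurable]: "c \<in> borel_measurable borel"
    unfolding c_def[abs_def] by measurable
  have pt: "ennreal ((c x)\<^sup>2) \<le> ennreal (L1_norm K) * (\<integral>\<^sup>+y. ennreal (\<bar>k (x - y)\<bar> * (G y)\<^sup>2) \<partial>lborel)" for x
  proof -
    have "ennreal \<bar>c x\<bar> \<le> (\<integral>\<^sup>+y. ennreal \<bar>k (x - y) * G y\<bar> \<partial>lborel)"
      unfolding c_def using integral_norm_bound_ennreal[OF convolution_integrable(1)[OF ik G(1,2)]] by simp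
    also have "\<dots> = (\<integral>\<^sup>+y. ennreal (sqrt \<bar>k (x - y)\<bar>) * ennreal (sqrt \<bar>k (x - y)\<bar> * \<bar>G y\<bar>) \<partial>lborel)"
      by (intro nn_integral_cong) (simp add: abs_mult flip: ennreal_mult mult.assoc)
    finally have "(ennreal \<bar>c x\<bar>)\<^sup>2 \<le> (\<integral>\<^sup>+y. ennreal (sqrt \<bar>k (x - y)\<bar>) * ennreal (sqrt \<bar>k (x - y)\<bar> * \<bar>G y\<bar>) \<partial>lborel)\<^sup>2"
      by (rule power_mono) simp
    also have "\<dots> \<le> (\<integral>\<^sup>+y. (ennreal (sqrt \<bar>k (x - y)\<bar>))\<^sup>2 \<partial>lborel) * (\<integral>\<^sup>+y. (ennreal (sqrt \<bar>k (x - y)\<bar> * \<bar>G y\<bar>))\<^sup>2 \<partial>lborel)"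
      by (rule Cauchy_Schwarz_nn_integral) measurable
    also have "\<dots> = ennreal (L1_norm K) * (\<integral>\<^sup>+y. ennreal (\<bar>k (x - y)\<bar> * (G y)\<^sup>2) \<partial>lborel)"
      by (simp add: ennreal_power power_mult_distrib k1)
    finally show ?thesis by (simp add: ennreal_power)
  qed
  have L1nn: "0 \<le> L1_norm K" by (simp add: L1_norm_def)
  have "(\<integral>\<^sup>+x. ennreal ((c x)\<^sup>2) \<partial>lborel)
      \<le> (\<integral>\<^sup>+x. ennreal (L1_norm K) * (\<integral>\<^sup>+y. ennreal (\<bar>k (x - y)\<bar> * (G y)\<^sup>2) \<partial>lborel) \<partial>lborel)"
    by (intro nn_integral_mono pt)
  also have "\<dots> = ennreal (L1_norm K) * (\<integral>\<^sup>+x. (\<integral>\<^sup>+y. ennreal (\<bar>k (x - y)\<bar> * (G y)\<^sup>2) \<partial>lborel) \<partial>lborel)"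
    by (rule nn_integral_cmult) measurable
  also have "(\<integral>\<^sup>+x. (\<integral>\<^sup>+y. ennreal (\<bar>k (x - y)\<bar> * (G y)\<^sup>2) \<partial>lborel) \<partial>lborel)
      = (\<integral>\<^sup>+y. (\<integral>\<^sup>+x. ennreal (\<bar>k (x - y)\<bar> * (G y)\<^sup>2) \<partial>lborel) \<partial>lborel)"
    by (rule lborel_pair.Fubini') measurable
  also have "\<dots> = (\<integral>\<^sup>+y. ennreal (L1_norm K) * ennreal ((G y)\<^sup>2) \<partial>lborel)"
    by (intro nn_integral_cong) (simp add: ennreal_mult nn_integral_multc k2)
  also have "\<dots> = ennreal (L1_norm K) * (\<integral>\<^sup>+y. ennreal ((G y)\<^sup>2) \<partial>lborel)"
    by (rule nn_integral_cmult) measurable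
  also have "(\<integral>\<^sup>+y. ennreal ((G y)\<^sup>2) \<partial>lborel) = ennreal ((L2_norm G)\<^sup>2)"
    using L2_norm_eq_nn_integral[OF G(3)] by (simp add: nn_integral_completion)
  also have "ennreal (L1_norm K) * (ennreal (L1_norm K) * ennreal ((L2_norm G)\<^sup>2)) = ennreal ((L1_norm K * L2_norm G)\<^sup>2)"
    using L1nn by (simp add: power2_eq_square mult_ac flip: ennreal_mult)
  finally have le: "(\<integral>\<^sup>+x. ennreal ((c x)\<^sup>2) \<partial>lebesgue) \<le> ennreal ((L1_norm K * L2_norm G)\<^sup>2)"
    by (simp add: nn_integral_completion)
  have m: "c \<in> borel_measurable lebesgue" by (rule measurable_completion) simp
  have "(\<lambda>x. LINT y|lebesgue. K (x - y) * G y) = c"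
    by (simp add: c_def fun_eq_iff eq[OF G(1)])
  then show "(\<lambda>x. LINT y|lebesgue. K (x - y) * G y) \<in> L2"
    "L2_norm (\<lambda>x. LINT y|lebesgue. K (x - y) * G y) \<le> L1_norm K * L2_norm G"
    using L2I_nn_integral[OF m le] L1nn by simp_all
qed

text \<open>Fubini's theorem moves the convolution onto the test function. With $\psi = \varphi'$ the inner integral
  has exactly the form to which the weak derivative of \<open>K\<close> applies.\<close>

lemma convolution_adjoint:
  fixes K G \<psi> :: "real \<Rightarrow> real"
  assumes K: "integrable lebesgue K" and G: "G \<in> borel_measurable borel" "\<And>x. \<bar>G x\<bar> \<le> B"
    and \<psi>: "\<psi> \<in> borel_measurable borel" "integrable lborel \<psi>"
  shows "(LINT x|lebesgue. (LINT y|lebesgue. K (x - y) * G y) * \<psi> x)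
    = (LINT y|lborel. G y * (LINT z|lebesgue. K z * \<psi> (y + z)))"
proof -
  obtain k where [measurable]: "k \<in> borel_measurable borel" and ik: "integrable lborel k"
    and L1: "(LINT z|lborel. \<bar>k z\<bar>) = L1_norm K"
    and eq: "\<And>G x. G \<in> borel_measurable borel \<Longrightarrow>
      (LINT y|lebesgue. K (x - y) * G y) = (LINT y|lborel. k (x - y) * G y)"
    by (rule convolution_borel_representative[OF K]) (rule that)
  note [measurable] = G(1) \<psi>(1)
  have B: "0 \<le> B" using G(2)[of 0] by linarith
  have int: "integrable (lborel \<Otimes>\<^sub>M lborel) (\<lambda>(x, y). k (x - y) * G y * \<psi> x)"
  proof (rule lborel_pair.Fubini_integrable)
    show "AE x in lborel. integrable lborel (\<lambda>y. case (x, y) of (x, y) \<Rightarrow> k (x - y) * G y * \<psi> x)"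
      using convolution_integrable(1)[OF ik G] by simp
    show "integrable lborel (\<lambda>x. LINT y|lborel. norm (case (x, y) of (x, y) \<Rightarrow> k (x - y) * G y * \<psi> x))"
    proof (rule Bochner_Integration.integrable_bound[OF integrable_mult_right[OF \<psi>(2), of "B * L1_norm K"]])
      show "(\<lambda>x. LINT y|lborel. norm (case (x, y) of (x, y) \<Rightarrow> k (x - y) * G y * \<psi> x)) \<in> borel_measurable lborel"
        by measurable
      have "(LINT y|lborel. \<bar>k (x - y) * G y * \<psi> x\<bar>) \<le> B * L1_norm K * \<bar>\<psi> x\<bar>" for x
      proof -
        have "(LINT y|lborel. \<bar>k (x - y) * G y * \<psi> x\<bar>) = (LINT y|lborel. \<bar>k (x - y) * G y\<bar>) * \<bar>\<psi> x\<bar>"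
          by (simp add: abs_mult)
        also have "\<dots> \<le> B * L1_norm K * \<bar>\<psi> x\<bar>"
          using convolution_integrable(2)[OF ik G, of x] unfolding L1 by (rule mult_right_mono) simp
        finally show ?thesis .
      qed
      then have "\<bar>LINT y|lborel. \<bar>k (x - y) * G y * \<psi> x\<bar>\<bar> \<le> \<bar>B * L1_norm K * \<psi> x\<bar>" for x
        using B by (simp add: abs_mult L1_norm_def)
      then show "AE x in lborel. norm (LINT y|lborel. norm (case (x, y) of (x, y) \<Rightarrow> k (x - y) * G y * \<psi> x))
          \<le> norm (B * L1_norm K * \<psi> x)"
        by simp
    qed
  qed measurable
  have "(LINT x|lebesgue. (LINT y|lebesgue. K (x - y) * G y) * \<psi> x)
      = (LINT x|lebesgue. (LINT y|lborel. k (x - y) * G y) * \<psi> x)"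
    by (simp add: eq)
  also have "\<dots> = (LINT x|lborel. (LINT y|lborel. k (x - y) * G y) * \<psi> x)"
    by (rule integral_completion) measurable
  also have "\<dots> = (LINT x|lborel. (LINT y|lborel. k (x - y) * G y * \<psi> x))"
    by simp
  also have "\<dots> = (LINT y|lborel. (LINT x|lborel. k (x - y) * G y * \<psi> x))"
    by (rule lborel_pair.Fubini_integral[OF int, symmetric])
  also have "\<dots> = (LINT y|lborel. G y * (LINT z|lebesgue. K z * \<psi> (y + z)))"
  proof (intro Bochner_Integration.integral_cong refl)
    fix y
    have "(LINT z|lebesgue. K z * \<psi> (y + z)) = (LINT z|lebesgue. K (0 - z) * \<psi> (y - z))"
      by (subst convolution_commute[of K 0]) simp
    also have "\<dots> = (LINT z|lborel. k (0 - z) * \<psi> (y - z))"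
      by (rule eq) measurable
    also have "\<dots> = (LINT x|lborel. k (x - y) * \<psi> x)"
      by (subst lborel_integral_real_affine[where c = "-1" and t = y]) simp_all
    finally have "(LINT z|lebesgue. K z * \<psi> (y + z)) = (LINT x|lborel. k (x - y) * \<psi> x)" .
    moreover have "(LINT x|lborel. k (x - y) * G y * \<psi> x) = G y * (LINT x|lborel. k (x - y) * \<psi> x)"
      by (simp add: mult_ac flip: Bochner_Integration.integral_mult_right_zero)
    ultimately show "(LINT x|lborel. k (x - y) * G y * \<psi> x) = G y * (LINT z|lebesgue. K z * \<psi> (y + z))"
      by simp
  qed
  finally show ?thesis .
qed

lemma test_function_integrable_lborel:
  assumes "test_function \<phi>"
  shows "integrable lborel \<phi>" "integrable lborel (deriv \<phi>)"
    "\<phi> \<in> borel_measurable borel" "deriv \<phi> \<in> borel_measurable borel"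
proof -
  show m: "\<phi> \<in> borel_measurable borel" "deriv \<phi> \<in> borel_measurable borel"
    using test_function_smooth[OF assms] by (auto intro: smooth_measurable smooth_deriv)
  have "locally_integrable (\<lambda>x. 1)"
    by (rule continuous_locally_integrable) simp
  from test_function_integrable[OF assms this]
  show "integrable lborel \<phi>" "integrable lborel (deriv \<phi>)"
    using m by (simp_all add: integrable_completion)
qed

text \<open>The weak derivative of $K * G$ is $K' * G$: both are paired with a test function by
  \<open>convolution_adjoint\<close>, and the inner integrals agree by the definition of $K'$ applied to the
  translates of the test function. The whole derivative falls on the kernel, so the bound contains only the
  $L^2$ norm of \<open>G\<close>. Continuity follows by dominated convergence from that of \<open>G\<close>.\<close>

lemma W11_convolution_H1:
  assumes K: "K \<in> W11" and G: "continuous_on UNIV G" "\<And>x. \<bar>G x\<bar> \<le> B" "G \<in> L2"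
  shows "(\<lambda>x. LINT y|lebesgue. K (x - y) * G y) \<in> H1"
    and "H1_norm (\<lambda>x. LINT y|lebesgue. K (x - y) * G y) \<le> W11_norm K * L2_norm G"
proof -
  define K' where "K' = weak_deriv K"
  define c where "c x = (LINT y|lebesgue. K (x - y) * G y)" for x
  define c' where "c' x = (LINT y|lebesgue. K' (x - y) * G y)" for x
  have iK: "integrable lebesgue K" "integrable lebesgue K'"
    using K by (auto simp: W11_def K'_def)
  have wK: "has_weak_derivative K K'"
    using K someI_ex[of "has_weak_derivative K"]
    by (auto simp: W11_def weakly_differentiable_def weak_deriv_def K'_def)
  have mG: "G \<in> borel_measurable borel" by (rule borel_measurable_continuous_onI[OF G(1)])
  have Y: "c \<in> L2" "L2_norm c \<le> L1_norm K * L2_norm G" "c' \<in> L2" "L2_norm c' \<le> L1_norm K' * L2_norm G"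
    unfolding c_def[abs_def] c'_def[abs_def]
    using Young_L1_L2[OF iK(1) mG G(2,3)] Young_L1_L2[OF iK(2) mG G(2,3)] by auto
  have "continuous_on UNIV c"
    unfolding continuous_on_sequentially comp_def
  proof (intro ballI allI impI)
    fix x and s :: "nat \<Rightarrow> real"
    assume "(\<forall>n. s n \<in> UNIV) \<and> s \<longlonglongrightarrow> x"
    then have s: "s \<longlonglongrightarrow> x" by simp
    have mz: "(\<lambda>z. K z * G (t - z)) \<in> borel_measurable lebesgue" for t
      by (intro borel_measurable_times borel_measurable_integrable[OF iK(1)] continuous_measurable_lebesgue
          continuous_on_compose2[OF G(1)] continuous_intros) auto
    show "(\<lambda>n. c (s n)) \<longlonglongrightarrow> c x"
      unfolding c_def convolution_commute
    proof (rule integral_dominated_convergence[where w = "\<lambda>z. B * \<bar>K z\<bar>"])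
      show "integrable lebesgue (\<lambda>z. B * \<bar>K z\<bar>)" using iK(1) by simp
      show "AE z in lebesgue. (\<lambda>n. K z * G (s n - z)) \<longlonglongrightarrow> K z * G (x - z)"
      proof (intro always_eventually allI tendsto_mult tendsto_const)
        fix z
        have "isCont G (x - z)" using G(1) by (simp add: continuous_on_eq_continuous_at)
        then show "(\<lambda>n. G (s n - z)) \<longlonglongrightarrow> G (x - z)"
          by (rule isCont_tendsto_compose) (intro tendsto_intros s)
      qed
      show "AE z in lebesgue. norm (K z * G (s n - z)) \<le> B * \<bar>K z\<bar>" for n
      proof (intro always_eventually allI)
        fix z
        show "norm (K z * G (s n - z)) \<le> B * \<bar>K z\<bar>"
          using mult_left_mono[OF G(2)[of "s n - z"], of "\<bar>K z\<bar>"] by (simp add: abs_mult mult.commute)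
      qed
    qed (rule mz)+
  qed
  moreover have "has_weak_derivative c c'"
    unfolding has_weak_derivative_def
  proof (intro conjI allI impI)
    show "locally_integrable c" "locally_integrable c'"
      using Y L2_locally_integrable by auto
    fix \<phi> assume t: "test_function \<phi>"
    note \<phi> = test_function_integrable_lborel[OF t]
    have inner: "(LINT z|lebesgue. K z * deriv \<phi> (y + z)) = - (LINT z|lebesgue. K' z * \<phi> (y + z))" for y
    proof -
      have "test_function (\<lambda>z. \<phi> (y + 1 * z))"
        by (rule test_function_affine[OF t]) simp
      then have "(LINT z|lebesgue. K z * deriv (\<lambda>z. \<phi> (y + z)) z) = - (LINT z|lebesgue. K' z * \<phi> (y + z))"
        using wK by (simp add: has_weak_derivative_def)
      moreover have "deriv (\<lambda>z. \<phi> (y + z)) = (\<lambda>z. deriv \<phi> (y + z))"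
      proof (rule ext, rule DERIV_imp_deriv)
        fix z
        have "((\<lambda>z. \<phi> (z + y)) has_real_derivative deriv \<phi> (z + y)) (at z)"
          using smooth_has_derivative[OF test_function_smooth[OF t]] by (simp flip: DERIV_shift)
        then show "((\<lambda>z. \<phi> (y + z)) has_real_derivative deriv \<phi> (y + z)) (at z)"
          by (simp add: add.commute)
      qed
      ultimately show ?thesis by simp
    qed
    have "(LINT x|lebesgue. c x * deriv \<phi> x) = (LINT y|lborel. G y * (LINT z|lebesgue. K z * deriv \<phi> (y + z)))"
      unfolding c_def by (rule convolution_adjoint[OF iK(1) mG G(2) \<phi>(4,2)])
    also have "\<dots> = - (LINT y|lborel. G y * (LINT z|lebesgue. K' z * \<phi> (y + z)))"
      unfolding inner by simp
    also have "\<dots> = - (LINT x|lebesgue. c' x * \<phi> x)"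
      unfolding c'_def by (subst convolution_adjoint[OF iK(2) mG G(2) \<phi>(3,1)]) simp
    finally show "(LINT x|lebesgue. c x * deriv \<phi> x) = - (LINT x|lebesgue. c' x * \<phi> x)" .
  qed
  ultimately have H: "c \<in> H1" "H1_norm c = sqrt ((L2_norm c)\<^sup>2 + (L2_norm c')\<^sup>2)"
    using H1I(1)[OF _ Y(1) _ Y(3)] H1_norm_eq[OF _ Y(1) _ Y(3)] by auto
  then show "(\<lambda>x. LINT y|lebesgue. K (x - y) * G y) \<in> H1"
    by (simp add: c_def[abs_def])
  have "H1_norm c \<le> L2_norm c + L2_norm c'"
    unfolding H(2) by (rule sqrt_sum_squares_le_sum) simp_all
  also have "\<dots> \<le> W11_norm K * L2_norm G"
    using Y(2,4) by (simp add: W11_norm_def K'_def distrib_right)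
  finally show "H1_norm (\<lambda>x. LINT y|lebesgue. K (x - y) * G y) \<le> W11_norm K * L2_norm G"
    by (simp add: c_def[abs_def])
qed

section \<open>Vector-valued functions and the fixed point principle\<close>

lemma H1_vec_norm_eq_L2_set:
  "H1_vec_norm u = L2_set (\<lambda>m. H1_norm (\<lambda>x. u x $ m)) UNIV"
  unfolding H1_vec_norm_def L2_set_def H1_norm_def by (simp add: sum.distrib)

lemma H1_vec_norm_nonneg [simp]: "0 \<le> H1_vec_norm u"
  by (simp add: H1_vec_norm_eq_L2_set)

lemma H1_norm_component_le: "H1_norm (\<lambda>x. u x $ m) \<le> H1_vec_norm u"
  unfolding H1_vec_norm_eq_L2_set by (rule member_le_L2_set) simp_all

lemma H1_vec_norm_minus_commute:
  assumes "u \<in> H1_vec" "v \<in> H1_vec"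
  shows "H1_vec_norm (\<lambda>x. u x - v x) = H1_vec_norm (\<lambda>x. v x - u x)"
proof -
  have "H1_norm (\<lambda>x. (u x - v x) $ m) = H1_norm (\<lambda>x. (v x - u x) $ m)" for m
    using H1_cmult(2)[OF H1_diff, of "\<lambda>x. v x $ m" "\<lambda>x. u x $ m" "-1"] assms
    by (simp add: H1_vec_def)
  then show ?thesis by (simp add: H1_vec_norm_eq_L2_set)
qed

lemma H1_vec_add:
  assumes "u \<in> H1_vec" "v \<in> H1_vec"
  shows "(\<lambda>x. u x + v x) \<in> H1_vec" "H1_vec_norm (\<lambda>x. u x + v x) \<le> H1_vec_norm u + H1_vec_norm v"
proof -
  have uv: "(\<lambda>x. u x $ m) \<in> H1" "(\<lambda>x. v x $ m) \<in> H1" for m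
    using assms by (auto simp: H1_vec_def)
  show "(\<lambda>x. u x + v x) \<in> H1_vec"
    using H1_add(1)[OF uv] by (simp add: H1_vec_def)
  have "H1_vec_norm (\<lambda>x. u x + v x) \<le> L2_set (\<lambda>m. H1_norm (\<lambda>x. u x $ m) + H1_norm (\<lambda>x. v x $ m)) UNIV"
    unfolding H1_vec_norm_eq_L2_set
    by (rule L2_set_mono) (use H1_add(2)[OF uv] in simp_all)
  also have "\<dots> \<le> H1_vec_norm u + H1_vec_norm v"
    unfolding H1_vec_norm_eq_L2_set by (rule L2_set_triangle_ineq)
  finally show "H1_vec_norm (\<lambda>x. u x + v x) \<le> H1_vec_norm u + H1_vec_norm v" .
qed

lemma H1_vec_diff:
  assumes "u \<in> H1_vec" "v \<in> H1_vec"
  shows "(\<lambda>x. u x - v x) \<in> H1_vec"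
  using assms H1_diff by (auto simp: H1_vec_def)

lemma H1_vec_norm_triangle_diff:
  assumes "u \<in> H1_vec" "v \<in> H1_vec" "w \<in> H1_vec"
  shows "H1_vec_norm (\<lambda>x. u x - w x) \<le> H1_vec_norm (\<lambda>x. u x - v x) + H1_vec_norm (\<lambda>x. v x - w x)"
  using H1_vec_add(2)[OF H1_vec_diff[OF assms(1,2)] H1_vec_diff[OF assms(2,3)]] by simp

text \<open>The scalar embedding is applied to the squares of the components; this is why the constant
  does not depend on the dimension.\<close>

lemma H1_vec_sup_bound:
  assumes "u \<in> H1_vec"
  shows "norm (u x) \<le> (1 / sqrt 2) * H1_vec_norm u"
proof (rule power2_le_imp_le)
  have "(norm (u x))\<^sup>2 = (\<Sum>m\<in>UNIV. (u x $ m)\<^sup>2)"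
    by (simp add: norm_vec_def L2_set_def sum_nonneg)
  also have "\<dots> \<le> (\<Sum>m\<in>UNIV. (H1_norm (\<lambda>x. u x $ m))\<^sup>2 / 2)"
    using assms by (intro sum_mono H1_sup_bound) (simp add: H1_vec_def)
  also have "\<dots> = ((1 / sqrt 2) * H1_vec_norm u)\<^sup>2"
    by (simp add: H1_vec_norm_eq_L2_set L2_set_def power_mult_distrib power_divide sum_nonneg sum_divide_distrib)
  finally show "(norm (u x))\<^sup>2 \<le> ((1 / sqrt 2) * H1_vec_norm u)\<^sup>2" .
qed simp

lemma H1_vec_eq_zero:
  assumes "u \<in> H1_vec" "H1_vec_norm u = 0"
  shows "u x = 0"
  using H1_vec_sup_bound[OF assms(1), of x] assms(2) by simp

lemma H1_vec_norm_L2: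
  assumes "u \<in> H1_vec"
  shows "(\<lambda>x. norm (u x)) \<in> L2" "L2_norm (\<lambda>x. norm (u x)) \<le> H1_vec_norm u"
proof -
  have u: "(\<lambda>x. u x $ m) \<in> H1" for m using assms by (auto simp: H1_vec_def)
  have n2: "(norm (u x))\<^sup>2 = (\<Sum>m\<in>UNIV. (u x $ m)\<^sup>2)" for x
    by (simp add: norm_vec_def L2_set_def sum_nonneg)
  have "(\<lambda>x. sqrt (\<Sum>m\<in>UNIV. (u x $ m)\<^sup>2)) \<in> borel_measurable lebesgue"
    using L2D(1)[OF H1D(2)[OF u]] by measurable
  then have m: "(\<lambda>x. norm (u x)) \<in> borel_measurable lebesgue"
    by (simp add: norm_vec_def L2_set_def)
  have i: "integrable lebesgue (\<lambda>x. (u x $ m)\<^sup>2)" for m by (rule L2D(2)[OF H1D(2)[OF u]])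
  then show "(\<lambda>x. norm (u x)) \<in> L2"
    using m by (simp add: L2_def n2)
  have "(L2_norm (\<lambda>x. norm (u x)))\<^sup>2 = (\<Sum>m\<in>UNIV. (L2_norm (\<lambda>x. u x $ m))\<^sup>2)"
    unfolding L2_norm_power2 n2 using i by (rule Bochner_Integration.integral_sum)
  also have "\<dots> \<le> (\<Sum>m\<in>UNIV. (H1_norm (\<lambda>x. u x $ m))\<^sup>2)"
    by (intro sum_mono power_mono H1_norm_ge_L2_norm) simp
  also have "\<dots> = (H1_vec_norm u)\<^sup>2"
    by (simp add: H1_vec_norm_eq_L2_set L2_set_def sum_nonneg)
  finally show "L2_norm (\<lambda>x. norm (u x)) \<le> H1_vec_norm u"
    by (rule power2_le_imp_le) simp
qed

lemma H1_vec_complete_geometric: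
  fixes U :: "nat \<Rightarrow> real \<Rightarrow> real ^ 'n"
  assumes U: "\<And>n. U n \<in> H1_vec" and q: "0 < q" "q < 1" and C: "0 \<le> C"
    and step: "\<And>n. H1_vec_norm (\<lambda>x. U (Suc n) x - U n x) \<le> C * q ^ n"
  shows "\<exists>u\<in>H1_vec. (\<lambda>n. H1_vec_norm (\<lambda>x. U n x - u x)) \<longlonglongrightarrow> 0"
proof -
  have ex: "\<exists>f\<in>H1. (\<lambda>n. H1_norm (\<lambda>x. U n x $ m - f x)) \<longlonglongrightarrow> 0" for m
  proof (rule H1_complete_geometric[OF _ q C])
    show "(\<lambda>x. U n x $ m) \<in> H1" for n using U by (auto simp: H1_vec_def)
    show "H1_norm (\<lambda>x. U (Suc n) x $ m - U n x $ m) \<le> C * q ^ n" for n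
      using order_trans[OF H1_norm_component_le step[of n], of m] by simp
  qed
  obtain f where f': "\<forall>m. f m \<in> H1 \<and> (\<lambda>n. H1_norm (\<lambda>x. U n x $ m - f m x)) \<longlonglongrightarrow> 0"
    using choice[OF allI[OF ex[unfolded Bex_def]]] ..
  have f: "f m \<in> H1" "(\<lambda>n. H1_norm (\<lambda>x. U n x $ m - f m x)) \<longlonglongrightarrow> 0" for m
    using spec[OF f', of m] by (rule conjunct1, rule conjunct2)
  define u where "u x = (\<chi> m. f m x)" for x
  have u: "u \<in> H1_vec" using f(1) by (simp add: H1_vec_def u_def)
  have "(\<lambda>n. sqrt (\<Sum>m\<in>UNIV. (H1_norm (\<lambda>x. U n x $ m - f m x))\<^sup>2)) \<longlonglongrightarrow> sqrt (\<Sum>m\<in>(UNIV::'n set). 0\<^sup>2)"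
    by (intro tendsto_intros f)
  then have "(\<lambda>n. H1_vec_norm (\<lambda>x. U n x - u x)) \<longlonglongrightarrow> 0"
    by (simp add: H1_vec_norm_eq_L2_set L2_set_def u_def)
  then show ?thesis by (rule bexI[OF _ u])
qed

text \<open>Banach's iteration started at zero. Functions at distance zero are equal because elements of
  the space are continuous representatives.\<close>

lemma strict_contraction_fixed_point:
  fixes f :: "(real \<Rightarrow> real ^ 'n) \<Rightarrow> real \<Rightarrow> real ^ 'n"
  assumes self: "\<And>v. v \<in> B_ball \<rho> \<Longrightarrow> f v \<in> B_ball \<rho>" and contr: "strict_contraction_on (B_ball \<rho>) f"
    and \<rho>: "0 \<le> \<rho>"
  shows "\<exists>u\<in>B_ball \<rho>. \<forall>w\<in>B_ball \<rho>. f w = w \<longleftrightarrow> w = u"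
proof -
  obtain q0 where q0: "0 \<le> q0" "q0 < 1"
    "\<And>v w. v \<in> B_ball \<rho> \<Longrightarrow> w \<in> B_ball \<rho> \<Longrightarrow>
      H1_vec_norm (\<lambda>x. f v x - f w x) \<le> q0 * H1_vec_norm (\<lambda>x. v x - w x)"
    using contr unfolding strict_contraction_on_def by blast
  \<comment> \<open>Completeness was shown for a positive ratio, so a vanishing contraction constant is enlarged.\<close>
  define q where "q = max q0 (1/2)"
  have q: "0 < q" "q < 1" using q0 by (auto simp: q_def)
  have lip: "H1_vec_norm (\<lambda>x. f v x - f w x) \<le> q * H1_vec_norm (\<lambda>x. v x - w x)"
    if "v \<in> B_ball \<rho>" "w \<in> B_ball \<rho>" for v w
    using q0(3)[OF that] by (rule order_trans) (simp add: q_def mult_right_mono)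
  have B: "v \<in> H1_vec" if "v \<in> B_ball \<rho>" for v
    using that by (simp add: B_ball_def)
  define U where "U n = (f ^^ n) (\<lambda>x. 0)" for n
  have U_Suc: "U (Suc n) = f (U n)" for n by (simp add: U_def)
  have UB: "U n \<in> B_ball \<rho>" for n
  proof (induction n)
    case 0
    show ?case using \<rho> by (simp add: U_def B_ball_def H1_vec_def H1_zero H1_vec_norm_eq_L2_set L2_set_def)
  next
    case (Suc n)
    then show ?case unfolding U_Suc by (rule self)
  qed
  define C where "C = H1_vec_norm (\<lambda>x. U (Suc 0) x - U 0 x)"
  have step: "H1_vec_norm (\<lambda>x. U (Suc n) x - U n x) \<le> C * q ^ n" for n
  proof (induction n)
    case (Suc n)
    have "H1_vec_norm (\<lambda>x. U (Suc (Suc n)) x - U (Suc n) x) \<le> q * H1_vec_norm (\<lambda>x. U (Suc n) x - U n x)"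
      using lip[OF UB[of "Suc n"] UB[of n]] by (simp add: U_Suc)
    also have "\<dots> \<le> q * (C * q ^ n)"
      using Suc q by (intro mult_left_mono) auto
    finally show ?case by (simp add: mult_ac)
  qed (simp add: C_def)
  have "0 \<le> C" by (simp add: C_def)
  then obtain u where u: "u \<in> H1_vec" and lim: "(\<lambda>n. H1_vec_norm (\<lambda>x. U n x - u x)) \<longlonglongrightarrow> 0"
    using H1_vec_complete_geometric[OF B[OF UB] q _ step] by blast
  have "H1_vec_norm u \<le> \<rho>"
  proof (rule LIMSEQ_le_const)
    show "(\<lambda>n. \<rho> + H1_vec_norm (\<lambda>x. U n x - u x)) \<longlonglongrightarrow> \<rho>"
      using tendsto_add[OF tendsto_const lim, of \<rho>] by simp
    have "H1_vec_norm u \<le> \<rho> + H1_vec_norm (\<lambda>x. U n x - u x)" for n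
    proof -
      have "H1_vec_norm u \<le> H1_vec_norm (U n) + H1_vec_norm (\<lambda>x. u x - U n x)"
        using H1_vec_add(2)[OF B[OF UB[of n]] H1_vec_diff[OF u B[OF UB[of n]]]] by simp
      also have "\<dots> \<le> \<rho> + H1_vec_norm (\<lambda>x. U n x - u x)"
        using UB[of n] H1_vec_norm_minus_commute[OF u B[OF UB[of n]]] by (simp add: B_ball_def)
      finally show ?thesis .
    qed
    then show "\<exists>N. \<forall>n\<ge>N. H1_vec_norm u \<le> \<rho> + H1_vec_norm (\<lambda>x. U n x - u x)" by blast
  qed
  then have uB: "u \<in> B_ball \<rho>" using u by (simp add: B_ball_def)
  have fu: "f u \<in> H1_vec" using self[OF uB] by (rule B)
  have "H1_vec_norm (\<lambda>x. f u x - u x) \<le> 0"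
  proof (rule LIMSEQ_le_const)
    show "(\<lambda>n. q * H1_vec_norm (\<lambda>x. U n x - u x) + H1_vec_norm (\<lambda>x. U (Suc n) x - u x)) \<longlonglongrightarrow> 0"
      using tendsto_add[OF tendsto_mult_left[OF lim, of q] LIMSEQ_Suc[OF lim]] by simp
    have "H1_vec_norm (\<lambda>x. f u x - u x) \<le> q * H1_vec_norm (\<lambda>x. U n x - u x) + H1_vec_norm (\<lambda>x. U (Suc n) x - u x)" for n
    proof -
      have "H1_vec_norm (\<lambda>x. f u x - u x) \<le> H1_vec_norm (\<lambda>x. f u x - U (Suc n) x) + H1_vec_norm (\<lambda>x. U (Suc n) x - u x)"
        by (rule H1_vec_norm_triangle_diff[OF fu B[OF UB] u])
      moreover have "H1_vec_norm (\<lambda>x. f u x - U (Suc n) x) \<le> q * H1_vec_norm (\<lambda>x. U n x - u x)"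
        using lip[OF uB UB[of n]] H1_vec_norm_minus_commute[OF u B[OF UB[of n]]] by (simp add: U_Suc)
      ultimately show ?thesis by simp
    qed
    then show "\<exists>N. \<forall>n\<ge>N. H1_vec_norm (\<lambda>x. f u x - u x) \<le> q * H1_vec_norm (\<lambda>x. U n x - u x) + H1_vec_norm (\<lambda>x. U (Suc n) x - u x)"
      by blast
  qed
  then have "H1_vec_norm (\<lambda>x. f u x - u x) = 0"
    using H1_vec_norm_nonneg[of "\<lambda>x. f u x - u x"] by linarith
  then have fix_u: "f u = u"
    using H1_vec_eq_zero[OF H1_vec_diff[OF fu u]] by (auto simp: fun_eq_iff)
  have "w = u" if w: "w \<in> B_ball \<rho>" "f w = w" for w
  proof -
    have "H1_vec_norm (\<lambda>x. w x - u x) \<le> q * H1_vec_norm (\<lambda>x. w x - u x)"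
      using lip[OF w(1) uB] w(2) fix_u by simp
    then have "(1 - q) * H1_vec_norm (\<lambda>x. w x - u x) \<le> 0" by (simp add: algebra_simps)
    then have "H1_vec_norm (\<lambda>x. w x - u x) = 0"
      using q H1_vec_norm_nonneg[of "\<lambda>x. w x - u x"] by (auto simp: mult_le_0_iff)
    then show ?thesis
      using H1_vec_eq_zero[OF H1_vec_diff[OF B[OF w(1)] u]] by (auto simp: fun_eq_iff)
  qed
  then show ?thesis using uB fix_u by blast
qed

section \<open>Estimates for the nonlinearity and for the product\<close>

lemma C_norm_upper:
  assumes "compact S" "continuous_on S f" "z \<in> S"
  shows "\<bar>f z\<bar> \<le> C_norm S f"
proof -
  have "compact ((\<lambda>z. \<bar>f z\<bar>) ` S)"
    using assms(1,2) by (intro compact_continuous_image continuous_intros)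
  then have "bdd_above ((\<lambda>z. \<bar>f z\<bar>) ` S)"
    by (intro bounded_imp_bdd_above compact_imp_bounded)
  then show ?thesis
    unfolding C_norm_def using assms(3) by (intro cSUP_upper)
qed

lemma C1_norm_nonneg:
  assumes "compact S" "S \<noteq> {}" "C1_on S f"
  shows "0 \<le> C1_norm S f"
proof -
  obtain z where "z \<in> S" using assms(2) by blast
  have "0 \<le> C_norm S h" if "continuous_on S h" for h
    using C_norm_upper[OF assms(1) that \<open>z \<in> S\<close>] by linarith
  then show ?thesis
    using assms(3) unfolding C1_norm_def C1_on_def
    by (intro add_nonneg_nonneg sum_nonneg) (auto intro: differentiable_imp_continuous_on)
qed

text \<open>The derivative within \<open>S\<close> is determined by its values on the coordinate axes, so its operator
  norm is at most the sum of the suprema of the partial derivatives; convexity turns this into a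
  Lipschitz bound.\<close>

lemma C1_norm_Lipschitz:
  fixes f :: "real ^ 'n \<Rightarrow> real"
  assumes S: "compact S" "convex S" and f: "C1_on S f" and zw: "z \<in> S" "w \<in> S"
  shows "\<bar>f z - f w\<bar> \<le> C1_norm S f * norm (z - w)"
proof -
  define D where "D y = frechet_derivative f (at y within S)" for y
  have D: "(f has_derivative D y) (at y within S)" if "y \<in> S" for y
    using f that unfolding C1_on_def differentiable_on_def D_def
    by (simp add: frechet_derivative_works)
  have "onorm (D y) \<le> C1_norm S f" if "y \<in> S" for y
  proof (rule onorm_le)
    fix h :: "real ^ 'n"
    have lin: "linear (D y)" using D[OF that] by (rule has_derivative_linear)
    have "h = (\<Sum>n\<in>UNIV. (h $ n) *\<^sub>R axis n 1)"
      using basis_expansion[of h] by (simp add: scalar_mult_eq_scaleR)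
    then have "D y h = (\<Sum>n\<in>UNIV. (h $ n) *\<^sub>R D y (axis n 1))"
      by (metis (no_types, lifting) lin linear_sum linear_cmul sum.cong)
    then have "norm (D y h) \<le> (\<Sum>n\<in>UNIV. \<bar>h $ n\<bar> * \<bar>D y (axis n 1)\<bar>)"
      by (simp add: order_trans[OF sum_abs] abs_mult)
    also have "\<dots> \<le> (\<Sum>n\<in>UNIV. norm h * C_norm S (partial_on S n f))"
    proof (intro sum_mono mult_mono component_le_norm_cart)
      fix n
      show "\<bar>D y (axis n 1)\<bar> \<le> C_norm S (partial_on S n f)"
        using C_norm_upper[OF S(1) _ that, of "partial_on S n f"] f
        by (simp add: C1_on_def partial_on_def D_def)
    qed auto
    also have "\<dots> = (\<Sum>n\<in>UNIV. C_norm S (partial_on S n f)) * norm h"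
      by (simp add: sum_distrib_left mult.commute)
    also have "\<dots> \<le> C1_norm S f * norm h"
    proof (rule mult_right_mono)
      have "continuous_on S f"
        using f by (simp add: C1_on_def differentiable_imp_continuous_on)
      from C_norm_upper[OF S(1) this that] have "0 \<le> C_norm S f" by linarith
      then show "(\<Sum>n\<in>UNIV. C_norm S (partial_on S n f)) \<le> C1_norm S f"
        by (simp add: C1_norm_def)
    qed simp
    finally show "norm (D y h) \<le> C1_norm S f * norm h" .
  qed
  from differentiable_bound[OF S(2) D this zw] show ?thesis by simp
qed

lemma H1_bounded_linear_add:
  assumes "H1_bounded_linear T" "\<phi> \<in> H1" "\<psi> \<in> H1"
  shows "T (\<lambda>x. \<phi> x + \<psi> x) = (\<lambda>x. T \<phi> x + T \<psi> x)"
  using assms unfolding H1_bounded_linear_def by blast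

lemma H1_onorm_bound:
  assumes T: "H1_bounded_linear T" and \<phi>: "\<phi> \<in> H1"
  shows "H1_norm (T \<phi>) \<le> H1_onorm T * H1_norm \<phi>"
proof -
  obtain C where C: "\<And>\<psi>. \<psi> \<in> H1 \<Longrightarrow> H1_norm (T \<psi>) \<le> C * H1_norm \<psi>"
    using T unfolding H1_bounded_linear_def by blast
  show ?thesis
  proof (cases "H1_norm \<phi> = 0")
    case True
    then show ?thesis using C[OF \<phi>] by simp
  next
    case False
    then have pos: "0 < H1_norm \<phi>" using H1_norm_nonneg[of \<phi>] by linarith
    have "H1_norm (T \<psi>) / H1_norm \<psi> \<le> \<bar>C\<bar>" if "\<psi> \<in> H1" for \<psi>
    proof (cases "H1_norm \<psi> = 0")
      case False
      then have "0 < H1_norm \<psi>" using H1_norm_nonneg[of \<psi>] by linarith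
      moreover have "H1_norm (T \<psi>) \<le> \<bar>C\<bar> * H1_norm \<psi>"
        by (rule order_trans[OF C[OF that]]) (intro mult_right_mono, auto)
      ultimately show ?thesis by (simp add: pos_divide_le_eq)
    qed simp
    then have "bdd_above ((\<lambda>\<psi>. H1_norm (T \<psi>) / H1_norm \<psi>) ` H1)"
      by (auto intro!: bdd_aboveI)
    then have "H1_norm (T \<phi>) / H1_norm \<phi> \<le> H1_onorm T"
      unfolding H1_onorm_def by (rule cSUP_upper[OF \<phi>])
    then show ?thesis using pos by (simp add: field_simps)
  qed
qed

text \<open>The single estimate behind both claims: it bounds the image of one function and, with differences
  as factors, each of the two summands in the difference of two images.\<close>

lemma H1_norm_product_estimate:
  assumes c: "H1_algebra_constant c" and T: "H1_bounded_linear T" "0 \<le> H1_onorm T" and \<phi>: "\<phi> \<in> H1" "H1_norm \<phi> \<le> a"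
    and K: "K \<in> W11"
    and G: "continuous_on UNIV G" "\<And>x. \<bar>G x\<bar> \<le> B" "G \<in> L2" "L2_norm G \<le> b"
  shows "(\<lambda>x. T \<phi> x * (LINT y|lebesgue. K (x - y) * G y)) \<in> H1"
    and "H1_norm (\<lambda>x. T \<phi> x * (LINT y|lebesgue. K (x - y) * G y)) \<le> c * (H1_onorm T * W11_norm K) * (a * b)"
proof -
  note conv = W11_convolution_H1[OF K G(1-3)]
  have c0: "0 < c" using c by (simp add: H1_algebra_constant_def)
  have W: "0 \<le> W11_norm K" by (simp add: W11_norm_def L1_norm_def)
  have Tp: "T \<phi> \<in> H1" using T(1) \<phi>(1) by (simp add: H1_bounded_linear_def)
  have prod: "(\<lambda>x. T \<phi> x * (LINT y|lebesgue. K (x - y) * G y)) \<in> H1"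
    "H1_norm (\<lambda>x. T \<phi> x * (LINT y|lebesgue. K (x - y) * G y))
      \<le> c * H1_norm (T \<phi>) * H1_norm (\<lambda>x. LINT y|lebesgue. K (x - y) * G y)"
    using bspec[OF bspec[OF conjunct2[OF c[unfolded H1_algebra_constant_def]] Tp] conv(1)]
    by simp_all
  show "(\<lambda>x. T \<phi> x * (LINT y|lebesgue. K (x - y) * G y)) \<in> H1" by (rule prod)
  have "H1_norm (T \<phi>) \<le> H1_onorm T * a"
    using H1_onorm_bound[OF T(1) \<phi>(1)] mult_left_mono[OF \<phi>(2) T(2)] by linarith
  moreover have "H1_norm (\<lambda>x. LINT y|lebesgue. K (x - y) * G y) \<le> W11_norm K * b"
    using conv(2) mult_left_mono[OF G(4) W] by linarith
  ultimately have "c * H1_norm (T \<phi>) * H1_norm (\<lambda>x. LINT y|lebesgue. K (x - y) * G y)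
      \<le> c * (H1_onorm T * a) * (W11_norm K * b)"
    using c0 T(2) order_trans[OF H1_norm_nonneg \<phi>(2)] by (intro mult_mono mult_left_mono) auto
  then show "H1_norm (\<lambda>x. T \<phi> x * (LINT y|lebesgue. K (x - y) * G y)) \<le> c * (H1_onorm T * W11_norm K) * (a * b)"
    using prod(2) by (simp add: mult_ac)
qed

lemma convolution_lebesgue_integrable:
  fixes K G :: "real \<Rightarrow> real"
  assumes K: "integrable lebesgue K" and G: "continuous_on UNIV G" "\<And>x. \<bar>G x\<bar> \<le> B"
  shows "integrable lebesgue (\<lambda>y. K (x - y) * G y)"
proof (rule Bochner_Integration.integrable_bound)
  have i: "integrable lebesgue (\<lambda>y. K (x - y))"
    using lebesgue_integrable_real_affine[OF K, of "-1" x] by simp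
  then show "integrable lebesgue (\<lambda>y. B * K (x - y))" by simp
  show "(\<lambda>y. K (x - y) * G y) \<in> borel_measurable lebesgue"
    by (intro borel_measurable_times borel_measurable_integrable[OF i] continuous_measurable_lebesgue G)
  show "AE y in lebesgue. norm (K (x - y) * G y) \<le> norm (B * K (x - y))"
  proof (intro always_eventually allI)
    fix y
    have "\<bar>G y\<bar> \<le> \<bar>B\<bar>" using G(2)[of y] by linarith
    from mult_left_mono[OF this, of "\<bar>K (x - y)\<bar>"]
    show "norm (K (x - y) * G y) \<le> norm (B * K (x - y))"
      by (simp add: abs_mult mult.commute)
  qed
qed

section \<open>The contraction\<close>

lemma Q_const_eq_L2_set: "Q_const T K = L2_set (\<lambda>m. H1_onorm (T m) * W11_norm (K m)) UNIV"
  by (simp add: Q_const_def L2_set_def power_mult_distrib)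

lemma H1_vec_norm_le_Q_const:
  assumes "\<And>m. H1_norm (\<lambda>x. u x $ m) \<le> C * (H1_onorm (T m) * W11_norm (K m))" and "0 \<le> C"
  shows "H1_vec_norm u \<le> C * Q_const T K"
proof -
  have "H1_vec_norm u \<le> L2_set (\<lambda>m. C * (H1_onorm (T m) * W11_norm (K m))) UNIV"
    unfolding H1_vec_norm_eq_L2_set by (rule L2_set_mono) (simp_all add: assms)
  also have "\<dots> = C * Q_const T K"
    unfolding Q_const_eq_L2_set using assms(2) by (rule L2_set_right_distrib[symmetric])
  finally show ?thesis .
qed

theorem theorem1p3:
  fixes \<rho> M c\<^sub>a :: real
    and K :: "'n::finite \<Rightarrow> real \<Rightarrow> real"
    and T :: "'n \<Rightarrow> (real \<Rightarrow> real) \<Rightarrow> (real \<Rightarrow> real)"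
    and u0 :: "real \<Rightarrow> real ^ 'n"
    and g :: "real ^ 'n \<Rightarrow> real ^ 'n"
  assumes "H1_algebra_constant c\<^sub>a"
    and "0 < \<rho>" and "\<rho> \<le> 1" and "M > 0"
    and "\<And>m. K m \<in> W11"
    and "\<And>m. \<not> (AE x in lebesgue. K m x = 0)"
    and "\<And>m. (\<lambda>x. u0 x $ m) \<in> H1"
    and "\<exists>m x. u0 x $ m \<noteq> 0"
    and "\<And>m. H1_bounded_linear (T m)"
    and "\<And>m. 0 < H1_onorm (T m)"
    and "\<And>m. g 0 $ m = 0"
    and "g \<in> D_set (I_ball u0) M"
    and "\<exists>z\<in>I_ball u0. g z \<noteq> 0"
    and "c\<^sub>a * M * (H1_vec_norm u0 + 1)\<^sup>2 * Q_const T K \<le> \<rho> / 2"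
  shows "(\<forall>v\<in>B_ball \<rho>. tau T K u0 g v \<in> B_ball \<rho>) \<and>
    strict_contraction_on (B_ball \<rho>) (tau T K u0 g) \<and>
    (\<exists>u\<^sub>p\<in>B_ball \<rho>.
       (\<forall>u\<in>B_ball \<rho>. tau T K u0 g u = u \<longleftrightarrow> u = u\<^sub>p) \<and>
       (\<forall>u\<in>B_ball \<rho>.
          (\<forall>m x. u x $ m = T m (\<lambda>y. u0 y $ m + u y $ m) x *
             (LINT y|lebesgue. K m (x - y) * g (u0 y + u y) $ m)) \<longleftrightarrow> u = u\<^sub>p))"
proof -
  define R where "R = H1_vec_norm u0 + 1"
  define I where "I = I_ball u0"
  define L where "L m = C1_norm I (\<lambda>z. g z $ m)" for m
  define G where "G v m y = g (u0 y + v y) $ m" for v m y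
  define P where "P v m = T m (\<lambda>y. u0 y $ m + v y $ m)" for v m
  let ?\<tau> = "tau T K u0 g"
  have \<tau>: "?\<tau> v x $ m = P v m x * (LINT y|lebesgue. K m (x - y) * G v m y)" for v x m
    by (simp add: tau_def P_def G_def)

  have u0: "u0 \<in> H1_vec" using assms(7) by (simp add: H1_vec_def)
  have c0: "0 < c\<^sub>a" using assms(1) by (simp add: H1_algebra_constant_def)
  have I: "I = cball 0 ((1 / sqrt 2) * R)" by (simp add: I_def I_ball_def R_def)
  have I_props: "compact I" "convex I" "0 \<in> I"
    by (auto simp: I R_def)
  have R1: "1 < R"
  proof -
    obtain m x where "u0 x $ m \<noteq> 0" using assms(8) by blast
    then have "H1_norm (\<lambda>x. u0 x $ m) \<noteq> 0"
      using H1_abs_le_norm[OF assms(7)[of m], of x] by auto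
    then have "0 < H1_norm (\<lambda>x. u0 x $ m)"
      using H1_norm_nonneg[of "\<lambda>x. u0 x $ m"] by linarith
    also have "\<dots> \<le> H1_vec_norm u0" by (rule H1_norm_component_le)
    finally show ?thesis by (simp add: R_def)
  qed

  have g_C1: "C1_on I (\<lambda>z. g z $ m)" for m
    using assms(12) by (simp add: D_set_def I_def)
  have L0: "0 \<le> L m" for m
    unfolding L_def using I_props by (intro C1_norm_nonneg g_C1) auto
  have LM: "L m \<le> M" for m
  proof -
    have "L m \<le> (\<Sum>m\<in>UNIV. L m)" by (rule member_le_sum) (simp_all add: L0)
    also have "\<dots> \<le> M" using assms(12) by (simp add: D_set_def C1_vec_norm_def L_def I_def)
    finally show ?thesis .
  qed
  have g_Lip: "\<bar>g z $ m - g w $ m\<bar> \<le> L m * norm (z - w)" if "z \<in> I" "w \<in> I" for z w m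
    unfolding L_def by (rule C1_norm_Lipschitz[OF I_props(1,2) g_C1 that])
  have g_cont: "continuous_on I (\<lambda>z. g z $ m)" for m
    using g_C1 by (simp add: C1_on_def differentiable_imp_continuous_on)

  have B: "v \<in> H1_vec" "H1_vec_norm v \<le> \<rho>" if "v \<in> B_ball \<rho>" for v
    using that by (auto simp: B_ball_def)
  have sum: "(\<lambda>x. u0 x + v x) \<in> H1_vec" "H1_vec_norm (\<lambda>x. u0 x + v x) \<le> R" if "v \<in> B_ball \<rho>" for v
    using H1_vec_add[OF u0 B(1)[OF that]] B(2)[OF that] assms(3) by (auto simp: R_def)
  have in_I: "u0 x + v x \<in> I" if "v \<in> B_ball \<rho>" for v x
  proof -
    have "norm (u0 x + v x) \<le> (1 / sqrt 2) * H1_vec_norm (\<lambda>x. u0 x + v x)"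
      by (rule H1_vec_sup_bound[OF sum(1)[OF that]])
    also have "\<dots> \<le> (1 / sqrt 2) * R"
      using sum(2)[OF that] by (intro mult_left_mono) auto
    finally show ?thesis by (simp add: I)
  qed
  have cont_sum: "continuous_on UNIV (\<lambda>x. u0 x + v x)" if "v \<in> B_ball \<rho>" for v
    using H1D(1) sum(1)[OF that] unfolding H1_vec_def
    by (subst continuous_on_componentwise) (auto simp: Basis_vec_def inner_axis)
  have G_cont: "continuous_on UNIV (G v m)" if "v \<in> B_ball \<rho>" for v m
    unfolding G_def[abs_def]
    by (rule continuous_on_compose2[OF g_cont cont_sum[OF that]]) (use in_I[OF that] in auto)
  have G_diff: "\<bar>G v m y - G w m y\<bar> \<le> L m * norm (v y - w y)" if "v \<in> B_ball \<rho>" "w \<in> B_ball \<rho>" for v w m y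
    unfolding G_def using g_Lip[OF in_I[OF that(1), of y] in_I[OF that(2), of y], of m] by simp
  have G_le: "\<bar>G v m y\<bar> \<le> L m * norm (u0 y + v y)" if "v \<in> B_ball \<rho>" for v m y
    unfolding G_def using g_Lip[OF in_I[OF that, of y] I_props(3), of m] assms(11) by simp
  have G_bd: "\<bar>G v m y\<bar> \<le> M * ((1 / sqrt 2) * R)" if "v \<in> B_ball \<rho>" for v m y
  proof -
    have "L m * norm (u0 y + v y) \<le> M * ((1 / sqrt 2) * R)"
      using in_I[OF that, of y] LM L0 assms(4) by (intro mult_mono) (auto simp: I)
    with G_le[OF that, of m y] show ?thesis by linarith
  qed
  have G_L2: "G v m \<in> L2" "L2_norm (G v m) \<le> M * R" if "v \<in> B_ball \<rho>" for v m
  proof -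
    note * = L2_mono[where C = "L m" and g = "G v m", OF H1_vec_norm_L2(1)[OF sum(1)[OF that]]
        continuous_measurable_lebesgue[OF G_cont[OF that]]]
    show "G v m \<in> L2" by (rule *(1)) (use G_le[OF that] in simp)
    have "L2_norm (G v m) \<le> \<bar>L m\<bar> * L2_norm (\<lambda>x. norm (u0 x + v x))"
      by (rule *(2)) (use G_le[OF that] in simp)
    also have "\<dots> \<le> M * R"
      using LM L0 assms(4) order_trans[OF H1_vec_norm_L2(2)[OF sum(1)[OF that]] sum(2)[OF that]]
      by (intro mult_mono) auto
    finally show "L2_norm (G v m) \<le> M * R" .
  qed
  have Gd_L2: "(\<lambda>y. G v m y - G w m y) \<in> L2"
    "L2_norm (\<lambda>y. G v m y - G w m y) \<le> M * H1_vec_norm (\<lambda>x. v x - w x)"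
    if "v \<in> B_ball \<rho>" "w \<in> B_ball \<rho>" for v w m
  proof -
    show d: "(\<lambda>y. G v m y - G w m y) \<in> L2" by (intro L2_diff G_L2 that)
    have vw: "(\<lambda>x. v x - w x) \<in> H1_vec" by (intro H1_vec_diff B that)
    have "L2_norm (\<lambda>y. G v m y - G w m y) \<le> \<bar>L m\<bar> * L2_norm (\<lambda>x. norm (v x - w x))"
      by (rule L2_mono(2)[OF H1_vec_norm_L2(1)[OF vw] L2D(1)[OF d]]) (use G_diff[OF that] in simp)
    also have "\<dots> \<le> M * H1_vec_norm (\<lambda>x. v x - w x)"
      using LM L0 assms(4) H1_vec_norm_L2(2)[OF vw] by (intro mult_mono) auto
    finally show "L2_norm (\<lambda>y. G v m y - G w m y) \<le> M * H1_vec_norm (\<lambda>x. v x - w x)" .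
  qed

  have T0: "0 \<le> H1_onorm (T m)" for m using assms(10)[of m] by simp
  note estimate = H1_norm_product_estimate[OF assms(1) assms(9) T0 _ _ assms(5)]
  have comp: "(\<lambda>y. u0 y $ m + v y $ m) \<in> H1" "H1_norm (\<lambda>y. u0 y $ m + v y $ m) \<le> R" if "v \<in> B_ball \<rho>" for v m
    using sum[OF that] order_trans[OF H1_norm_component_le sum(2)[OF that], of m] by (auto simp: H1_vec_def)

  have \<tau>_H1: "(\<lambda>x. ?\<tau> v x $ m) \<in> H1"
    "H1_norm (\<lambda>x. ?\<tau> v x $ m) \<le> (c\<^sub>a * M * R\<^sup>2) * (H1_onorm (T m) * W11_norm (K m))"
    if "v \<in> B_ball \<rho>" for v m
    using estimate[OF comp[OF that] G_cont[OF that] G_bd[OF that] G_L2[OF that], of m m]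
    unfolding \<tau> P_def by (simp_all add: power2_eq_square mult_ac)
  have \<tau>_vec: "?\<tau> v \<in> H1_vec" if "v \<in> B_ball \<rho>" for v
    using \<tau>_H1(1)[OF that] by (simp add: H1_vec_def)
  have self: "?\<tau> v \<in> B_ball \<rho>" if "v \<in> B_ball \<rho>" for v
  proof -
    have "H1_vec_norm (?\<tau> v) \<le> (c\<^sub>a * M * R\<^sup>2) * Q_const T K"
      by (rule H1_vec_norm_le_Q_const[OF \<tau>_H1(2)[OF that]]) (use c0 assms(4) in simp)
    also have "\<dots> \<le> \<rho>"
      using assms(14) assms(2) by (simp add: R_def)
    finally show ?thesis using \<tau>_vec[OF that] by (simp add: B_ball_def)
  qed

  \<comment> \<open>The factor 2 counts the two summands of the product difference; the smallness assumption has
    an extra factor \<open>R\<close>, which makes \<open>q\<close> at most \<open>\<rho> / R\<close>.\<close>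
  define q where "q = 2 * c\<^sub>a * M * R * Q_const T K"
  have q0: "0 \<le> q"
    using c0 assms(4) R1 by (simp add: q_def Q_const_def sum_nonneg)
  have "q * R \<le> \<rho>"
    using assms(14) by (simp add: q_def R_def[symmetric] power2_eq_square mult_ac)
  then have q1: "q < 1"
  proof (cases "q = 0")
    case False
    then have "q * 1 < q * R" using q0 R1 by (intro mult_strict_left_mono) auto
    with \<open>q * R \<le> \<rho>\<close> assms(3) show ?thesis by linarith
  qed simp

  have contr: "H1_vec_norm (\<lambda>x. ?\<tau> v x - ?\<tau> w x) \<le> q * H1_vec_norm (\<lambda>x. v x - w x)"
    if v: "v \<in> B_ball \<rho>" and w: "w \<in> B_ball \<rho>" for v w
  proof -
    define d where "d = H1_vec_norm (\<lambda>x. v x - w x)"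
    have d0: "0 \<le> d" by (simp add: d_def)
    have "H1_norm (\<lambda>x. (?\<tau> v x - ?\<tau> w x) $ m) \<le> (2 * c\<^sub>a * M * R * d) * (H1_onorm (T m) * W11_norm (K m))" for m
    proof -
      have dH: "(\<lambda>y. v y $ m - w y $ m) \<in> H1" "H1_norm (\<lambda>y. v y $ m - w y $ m) \<le> d"
        using H1_vec_diff[OF B(1)[OF v] B(1)[OF w]] H1_norm_component_le[of "\<lambda>x. v x - w x" m]
        by (auto simp: H1_vec_def d_def)
      \<comment> \<open>\<open>A\<close> carries the difference in the linear factor, \<open>D\<close> that in the nonlinear factor.\<close>
      define A where "A x = T m (\<lambda>y. v y $ m - w y $ m) x * (LINT y|lebesgue. K m (x - y) * G v m y)" for x
      define D where "D x = P w m x * (LINT y|lebesgue. K m (x - y) * (G v m y - G w m y))" for x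
      have T_diff: "P v m x = T m (\<lambda>y. v y $ m - w y $ m) x + P w m x" for x
      proof -
        have eq: "(\<lambda>y. u0 y $ m + v y $ m) = (\<lambda>y. (v y $ m - w y $ m) + (u0 y $ m + w y $ m))"
          by auto
        show ?thesis
          unfolding P_def eq H1_bounded_linear_add[OF assms(9) dH(1) comp(1)[OF w]] by (rule refl)
      qed
      have iK: "integrable lebesgue (K m)" using assms(5)[of m] by (simp add: W11_def)
      have conv_diff: "(LINT y|lebesgue. K m (x - y) * (G v m y - G w m y))
          = (LINT y|lebesgue. K m (x - y) * G v m y) - (LINT y|lebesgue. K m (x - y) * G w m y)" for x
        using convolution_lebesgue_integrable[OF iK G_cont[OF v] G_bd[OF v], of x m]
          convolution_lebesgue_integrable[OF iK G_cont[OF w] G_bd[OF w], of x m]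
        by (simp add: right_diff_distrib)
      have split: "(\<lambda>x. (?\<tau> v x - ?\<tau> w x) $ m) = (\<lambda>x. A x + D x)"
        unfolding A_def D_def conv_diff by (simp add: \<tau> T_diff algebra_simps)
      have A: "A \<in> H1" "H1_norm A \<le> c\<^sub>a * (H1_onorm (T m) * W11_norm (K m)) * (d * (M * R))"
        unfolding A_def[abs_def]
        using estimate[OF dH G_cont[OF v] G_bd[OF v] G_L2[OF v], of m m] by auto
      have bd: "\<bar>G v m y - G w m y\<bar> \<le> 2 * (M * ((1 / sqrt 2) * R))" for y
        using G_bd[OF v, of m y] G_bd[OF w, of m y] by linarith
      have D: "D \<in> H1" "H1_norm D \<le> c\<^sub>a * (H1_onorm (T m) * W11_norm (K m)) * (R * (M * d))"
        unfolding D_def[abs_def] P_def d_def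
        using estimate[OF comp[OF w] continuous_on_diff[OF G_cont[OF v] G_cont[OF w]] bd Gd_L2[OF v w], of m m]
        by auto
      show ?thesis
        unfolding split using H1_add(2)[OF A(1) D(1)] A(2) D(2) by (simp add: mult_ac)
    qed
    then have "H1_vec_norm (\<lambda>x. ?\<tau> v x - ?\<tau> w x) \<le> (2 * c\<^sub>a * M * R * d) * Q_const T K"
      by (rule H1_vec_norm_le_Q_const) (use c0 assms(4) R1 d0 in simp)
    then show ?thesis by (simp add: q_def d_def mult_ac)
  qed
  have strict: "strict_contraction_on (B_ball \<rho>) ?\<tau>"
    unfolding strict_contraction_on_def using q0 q1 contr by blast
  have pointwise: "(\<forall>m x. u x $ m = T m (\<lambda>y. u0 y $ m + u y $ m) x *
      (LINT y|lebesgue. K m (x - y) * g (u0 y + u y) $ m)) \<longleftrightarrow> ?\<tau> u = u" for u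
  proof (intro iffI allI)
    assume h: "\<forall>m x. u x $ m = T m (\<lambda>y. u0 y $ m + u y $ m) x *
      (LINT y|lebesgue. K m (x - y) * g (u0 y + u y) $ m)"
    show "?\<tau> u = u"
    proof (intro ext iffD2[OF vec_eq_iff] allI)
      show "?\<tau> u x $ m = u x $ m" for x m
        unfolding tau_def vec_lambda_beta by (rule h[rule_format, symmetric])
    qed
  next
    fix m x
    assume "?\<tau> u = u"
    then have "u x $ m = ?\<tau> u x $ m" by (simp only:)
    then show "u x $ m = T m (\<lambda>y. u0 y $ m + u y $ m) x *
      (LINT y|lebesgue. K m (x - y) * g (u0 y + u y) $ m)"
      unfolding tau_def vec_lambda_beta .
  qed
  have "\<exists>u\<in>B_ball \<rho>. \<forall>w\<in>B_ball \<rho>. ?\<tau> w = w \<longleftrightarrow> w = u"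
    by (rule strict_contraction_fixed_point[OF self strict]) (use assms(2) in simp_all)
  then obtain u\<^sub>p where u\<^sub>p: "u\<^sub>p \<in> B_ball \<rho>" "\<forall>w\<in>B_ball \<rho>. ?\<tau> w = w \<longleftrightarrow> w = u\<^sub>p"
    by (rule bexE)
  then show ?thesis
    unfolding pointwise
    by (intro conjI ballI self strict bexI[OF _ u\<^sub>p(1)] u\<^sub>p(2)[rule_format])
qed

end
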